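(* Two $E_0$-semigroups $\alpha$ and $\beta$ acting, respectively, on $\mathcal B(H)$ and $\mathcal B(K)$ are cocycle conjugate if and only if their product systems $\mathcal E_\alpha$ and $\mathcal E_\beta$ are isomorphic.
   Context: $H,K$ are separable infinite-dimensional Hilbert spaces. An $E_0$-semigroup on $\mathcal B(H)$ is a semigroup $\alpha=\{\alpha_t:t\ge0\}$ ($\alpha_0=\mathrm{id}$) of unit-preserving normal $*$-endomorphisms of $\mathcal B(H)$ such that $t\mapsto\langle\alpha_t(A)\xi,\eta\rangle$ is continuous for all $A\in\mathcal B(H)$, $\xi,\eta\in H$. A cocycle for $\alpha$ is a strongly continuous family $\{U_t:t\ge0\}$ of unitaries in $\mathcal B(H)$ with $U_{s+t}=U_s\alpha_s(U_t)$; the corresponding cocycle perturbation is the $E_0$-semigroup $A\mapsto U_t\alpha_t(A)U_t^*$. $\alpha$ and $\beta$ are conjugate if there is a $*$-isomorphism $\theta:\mathcal B(H)\to\mathcal B(K)$ with $\theta\circ\alpha_t=\beta_t\circ\theta$ for all $t\ge0$; they are cocycle conjugate if one of them is conjugate to a cocycle perturbation of the other. The (concrete) product system of $\alpha$ is $\mathcal E_\alpha=\{(t,T):t>0,\ T\in\mathcal E_\alpha(t)\}\subseteq(0,\infty)\times\mathcal B(H)$, where $\mathcal E_\alpha(t)=\{T\in\mathcal B(H):\alpha_t(A)T=TA\ \text{for all }A\in\mathcal B(H)\}$ is a Hilbert space with inner product given by $T^*S=\langle S,T\rangle\mathbf 1$. Multiplication is $(s,S)(t,T)=(s+t,ST)$,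 and the Borel structure is the one inherited from $(0,\infty)\times\mathcal B(H)$, where $\mathcal B(H)$ carries the $\sigma$-algebra generated by the weak operator topology. An isomorphism $\theta:\mathcal E_\alpha\to\mathcal E_\beta$ is an isomorphism of Borel spaces which restricts to a unitary operator $\mathcal E_\alpha(t)\to\mathcal E_\beta(t)$ for every $t>0$ and satisfies $\theta(xy)=\theta(x)\theta(y)$. *)

theory Defs
  imports "HOL-Analysis.Analysis"
begin

section \<open>Complex Hilbert spaces\<close>

class scaleC =
  fixes scaleC :: "complex \<Rightarrow> 'a \<Rightarrow> 'a"  (infixr "*\<^sub>C" 75)

class complex_vector = ab_group_add + scaleC +
  assumes scaleC_add_right: "c *\<^sub>C (x + y) = c *\<^sub>C x + c *\<^sub>C y"
    and scaleC_add_left: "(c + d) *\<^sub>C x = c *\<^sub>C x + d *\<^sub>C x"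
    and scaleC_scaleC: "c *\<^sub>C d *\<^sub>C x = (c * d) *\<^sub>C x"
    and scaleC_one: "1 *\<^sub>C x = x"

text \<open>
  The inner product is linear in the first variable.  Since the underlying real inner product
  is its real part, norm and topology inherited from \<^class>\<open>real_inner\<close> are the ones
  belonging to the complex inner product; \<^class>\<open>banach\<close> adds completeness.
\<close>

class complex_hilbert_space = complex_vector + real_inner + banach +
  fixes cinner :: "'a \<Rightarrow> 'a \<Rightarrow> complex"
  assumes scaleR_scaleC: "r *\<^sub>R x = complex_of_real r *\<^sub>C x"
    and cinner_add_left: "cinner (x + y) z = cinner x z + cinner y z"
    and cinner_scaleC_left: "cinner (c *\<^sub>C x) y = c * cinner x y"
    and cinner_commute: "cinner x y = cnj (cinner y x)"
    and inner_eq_Re_cinner: "inner x y = Re (cinner x y)"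

definition infinite_dimensional :: "'a::complex_vector itself \<Rightarrow> bool" where
  "infinite_dimensional _ \<longleftrightarrow> \<not> (\<exists>B :: 'a set. finite B \<and> module.span scaleC B = UNIV)"


section \<open>Bounded operators\<close>

typedef (overloaded) 'a bop =
  "{T :: 'a::complex_hilbert_space \<Rightarrow> 'a. bounded_linear T \<and> (\<forall>c x. T (c *\<^sub>C x) = c *\<^sub>C T x)}"
  morphisms apply_op Abs_bop
  by (rule exI[of _ "\<lambda>x. x"]) (simp add: bounded_linear_ident)

setup_lifting type_definition_bop

lemma bounded_linear_scaleC: "bounded_linear (\<lambda>x::'a::complex_hilbert_space. c *\<^sub>C x)"
proof (rule bounded_linear_intro[where K = "cmod c"])
  fix x y :: 'a and r :: real
  show "c *\<^sub>C (x + y) = c *\<^sub>C x + c *\<^sub>C y"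
    by (rule scaleC_add_right)
  show "c *\<^sub>C (r *\<^sub>R x) = r *\<^sub>R (c *\<^sub>C x)"
    by (simp add: scaleR_scaleC scaleC_scaleC mult.commute)
  have "cinner (c *\<^sub>C x) (c *\<^sub>C x) = c * cnj (c * cinner x x)"
    by (metis cinner_commute cinner_scaleC_left)
  also have "\<dots> = complex_of_real ((cmod c)\<^sup>2) * cinner x x"
    using cinner_commute[of x x] by (simp add: complex_norm_square mult_ac del: of_real_power)
  finally have "inner (c *\<^sub>C x) (c *\<^sub>C x) = (cmod c)\<^sup>2 * inner x x"
    by (simp add: inner_eq_Re_cinner)
  then have "norm (c *\<^sub>C x) = cmod c * norm x"
    by (simp add: norm_eq_sqrt_inner real_sqrt_mult)
  then show "norm (c *\<^sub>C x) \<le> norm x * cmod c"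
    by simp
qed

text \<open>Multiplication of operators is composition.\<close>

instantiation bop :: (complex_hilbert_space) "{complex_vector, monoid_mult}"
begin

lift_definition zero_bop :: "'a bop" is "\<lambda>x. 0"
  by (auto simp: bounded_linear_zero) (metis add_cancel_right_left scaleC_add_right)

lift_definition one_bop :: "'a bop" is "\<lambda>x. x"
  by (simp add: bounded_linear_ident)

lift_definition plus_bop :: "'a bop \<Rightarrow> 'a bop \<Rightarrow> 'a bop" is "\<lambda>S T x. S x + T x"
  by (simp add: bounded_linear_add scaleC_add_right)

lift_definition uminus_bop :: "'a bop \<Rightarrow> 'a bop" is "\<lambda>T x. - T x"
  by (auto simp: bounded_linear_minus bounded_linear.linear
      linear_neg[OF bounded_linear.linear[OF bounded_linear_scaleC]])

lift_definition minus_bop :: "'a bop \<Rightarrow> 'a bop \<Rightarrow> 'a bop" is "\<lambda>S T x. S x - T x"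
  by (auto simp: bounded_linear_sub linear_diff[OF bounded_linear.linear[OF bounded_linear_scaleC]])

lift_definition times_bop :: "'a bop \<Rightarrow> 'a bop \<Rightarrow> 'a bop" is "\<lambda>S T x. S (T x)"
  by (simp add: bounded_linear_compose)

lift_definition scaleC_bop :: "complex \<Rightarrow> 'a bop \<Rightarrow> 'a bop" is "\<lambda>c T x. c *\<^sub>C T x"
  by (auto simp: bounded_linear_compose[OF bounded_linear_scaleC] scaleC_scaleC mult.commute)

instance
  by standard (transfer; force simp: scaleC_add_left scaleC_add_right scaleC_scaleC scaleC_one)+

end

definition adj :: "'a::complex_hilbert_space bop \<Rightarrow> 'a bop" where
  "adj T = (THE S. \<forall>x y. cinner (apply_op T x) y = cinner x (apply_op S y))"

definition unitary_op :: "'a::complex_hilbert_space bop \<Rightarrow> bool" where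
  "unitary_op U \<longleftrightarrow> adj U * U = 1 \<and> U * adj U = 1"

definition weak_operator_topology :: "'a::complex_hilbert_space bop topology" where
  "weak_operator_topology = topology_generated_by
     {{A. cinner (apply_op A \<xi>) \<eta> \<in> G} | \<xi> \<eta> G. open G}"

definition sigma_weak_topology :: "'a::complex_hilbert_space bop topology" where
  "sigma_weak_topology = topology_generated_by
     {{A. (\<Sum>n. cinner (apply_op A (\<xi> n)) (\<eta> n)) \<in> G} | (\<xi> :: nat \<Rightarrow> 'a) \<eta> G.
        summable (\<lambda>n. (norm (\<xi> n))\<^sup>2) \<and> summable (\<lambda>n. (norm (\<eta> n))\<^sup>2) \<and> open G}"

text \<open>The \<open>\<sigma>\<close>-algebra generated by the weak operator topology.\<close>

definition op_borel :: "'a::complex_hilbert_space bop measure" where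
  "op_borel = sigma UNIV {G. openin weak_operator_topology G}"

definition star_hom ::
  "('a::complex_hilbert_space bop \<Rightarrow> 'b::complex_hilbert_space bop) \<Rightarrow> bool" where
  "star_hom \<phi> \<longleftrightarrow>
     Vector_Spaces.linear scaleC scaleC \<phi> \<and>
     (\<forall>A B. \<phi> (A * B) = \<phi> A * \<phi> B) \<and>
     (\<forall>A. \<phi> (adj A) = adj (\<phi> A))"

definition star_iso ::
  "('a::complex_hilbert_space bop \<Rightarrow> 'b::complex_hilbert_space bop) \<Rightarrow> bool" where
  "star_iso \<phi> \<longleftrightarrow> star_hom \<phi> \<and> bij \<phi>"

text \<open>Normality of a map on operators means continuity in the \<open>\<sigma>\<close>-weak (ultraweak) topologies.\<close>

definition normal_map ::
  "('a::complex_hilbert_space bop \<Rightarrow> 'b::complex_hilbert_space bop) \<Rightarrow> bool" where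
  "normal_map \<phi> \<longleftrightarrow> continuous_map sigma_weak_topology sigma_weak_topology \<phi>"


section \<open>\<open>E\<^sub>0\<close>-semigroups and cocycle conjugacy\<close>

text \<open>
  Families indexed by times \<open>t \<ge> 0\<close> are represented by functions on \<^typ>\<open>real\<close> whose values
  at negative arguments are never used.
\<close>

definition E0_semigroup ::
  "(real \<Rightarrow> 'a::complex_hilbert_space bop \<Rightarrow> 'a bop) \<Rightarrow> bool" where
  "E0_semigroup \<alpha> \<longleftrightarrow>
     \<alpha> 0 = id \<and>
     (\<forall>s\<ge>0. \<forall>t\<ge>0. \<alpha> (s + t) = \<alpha> s \<circ> \<alpha> t) \<and>
     (\<forall>t\<ge>0. star_hom (\<alpha> t) \<and> \<alpha> t 1 = 1 \<and> normal_map (\<alpha> t)) \<and>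
     (\<forall>A \<xi> \<eta>. continuous_on {0..} (\<lambda>t. cinner (apply_op (\<alpha> t A) \<xi>) \<eta>))"

definition cocycle ::
  "(real \<Rightarrow> 'a::complex_hilbert_space bop \<Rightarrow> 'a bop) \<Rightarrow> (real \<Rightarrow> 'a bop) \<Rightarrow> bool" where
  "cocycle \<alpha> U \<longleftrightarrow>
     (\<forall>t\<ge>0. unitary_op (U t)) \<and>
     (\<forall>\<xi>. continuous_on {0..} (\<lambda>t. apply_op (U t) \<xi>)) \<and>
     (\<forall>s\<ge>0. \<forall>t\<ge>0. U (s + t) = U s * \<alpha> s (U t))"

definition perturbation ::
  "(real \<Rightarrow> 'a::complex_hilbert_space bop \<Rightarrow> 'a bop) \<Rightarrow> (real \<Rightarrow> 'a bop) \<Rightarrow> real \<Rightarrow> 'a bop \<Rightarrow> 'a bop"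
  where "perturbation \<alpha> U t A = U t * \<alpha> t A * adj (U t)"

definition conjugate ::
  "(real \<Rightarrow> 'a::complex_hilbert_space bop \<Rightarrow> 'a bop) \<Rightarrow>
   (real \<Rightarrow> 'b::complex_hilbert_space bop \<Rightarrow> 'b bop) \<Rightarrow> bool" where
  "conjugate \<alpha> \<beta> \<longleftrightarrow> (\<exists>\<theta>. star_iso \<theta> \<and> (\<forall>t\<ge>0. \<theta> \<circ> \<alpha> t = \<beta> t \<circ> \<theta>))"

definition cocycle_conjugate ::
  "(real \<Rightarrow> 'a::complex_hilbert_space bop \<Rightarrow> 'a bop) \<Rightarrow>
   (real \<Rightarrow> 'b::complex_hilbert_space bop \<Rightarrow> 'b bop) \<Rightarrow> bool" where
  "cocycle_conjugate \<alpha> \<beta> \<longleftrightarrow>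
     (\<exists>U. cocycle \<beta> U \<and> conjugate \<alpha> (perturbation \<beta> U)) \<or>
     (\<exists>U. cocycle \<alpha> U \<and> conjugate \<beta> (perturbation \<alpha> U))"


section \<open>Product systems\<close>

definition fiber ::
  "(real \<Rightarrow> 'a::complex_hilbert_space bop \<Rightarrow> 'a bop) \<Rightarrow> real \<Rightarrow> 'a bop set" where
  "fiber \<alpha> t = {T. \<forall>A. \<alpha> t A * T = T * A}"

text \<open>Inner product of two elements of the same fiber, for which \<open>adj T * S\<close> is a scalar operator.\<close>

definition fiber_inner :: "'a::complex_hilbert_space bop \<Rightarrow> 'a bop \<Rightarrow> complex" where
  "fiber_inner S T = (THE c. adj T * S = c *\<^sub>C 1)"

definition product_system ::
  "(real \<Rightarrow> 'a::complex_hilbert_space bop \<Rightarrow> 'a bop) \<Rightarrow> (real \<times> 'a bop) set" where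
  "product_system \<alpha> = {(t, T). t > 0 \<and> T \<in> fiber \<alpha> t}"

definition ps_mult ::
  "real \<times> 'a::complex_hilbert_space bop \<Rightarrow> real \<times> 'a bop \<Rightarrow> real \<times> 'a bop" where
  "ps_mult x y = (fst x + fst y, snd x * snd y)"

text \<open>The trace \<open>\<sigma>\<close>-algebra; the product system need not be known to be measurable.\<close>

definition ps_borel ::
  "(real \<Rightarrow> 'a::complex_hilbert_space bop \<Rightarrow> 'a bop) \<Rightarrow> (real \<times> 'a bop) measure" where
  "ps_borel \<alpha> = restrict_space (borel \<Otimes>\<^sub>M op_borel) (product_system \<alpha>)"

text \<open>A unitary operator between subspaces: a linear bijection preserving the fiber inner products.\<close>

definition fiber_unitary ::
  "'a::complex_hilbert_space bop set \<Rightarrow> 'b::complex_hilbert_space bop set \<Rightarrow>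
   ('a bop \<Rightarrow> 'b bop) \<Rightarrow> bool" where
  "fiber_unitary E F u \<longleftrightarrow>
     bij_betw u E F \<and>
     (\<forall>S\<in>E. \<forall>T\<in>E. u (S + T) = u S + u T) \<and>
     (\<forall>c. \<forall>T\<in>E. u (c *\<^sub>C T) = c *\<^sub>C u T) \<and>
     (\<forall>S\<in>E. \<forall>T\<in>E. fiber_inner (u S) (u T) = fiber_inner S T)"

definition ps_isomorphism ::
  "(real \<Rightarrow> 'a::complex_hilbert_space bop \<Rightarrow> 'a bop) \<Rightarrow>
   (real \<Rightarrow> 'b::complex_hilbert_space bop \<Rightarrow> 'b bop) \<Rightarrow>
   (real \<times> 'a bop \<Rightarrow> real \<times> 'b bop) \<Rightarrow> bool" where
  "ps_isomorphism \<alpha> \<beta> \<theta> \<longleftrightarrow>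
     bij_betw \<theta> (product_system \<alpha>) (product_system \<beta>) \<and>
     \<theta> \<in> ps_borel \<alpha> \<rightarrow>\<^sub>M ps_borel \<beta> \<and>
     inv_into (product_system \<alpha>) \<theta> \<in> ps_borel \<beta> \<rightarrow>\<^sub>M ps_borel \<alpha> \<and>
     (\<forall>t>0. \<exists>u. fiber_unitary (fiber \<alpha> t) (fiber \<beta> t) u \<and>
                (\<forall>T\<in>fiber \<alpha> t. \<theta> (t, T) = (t, u T))) \<and>
     (\<forall>x\<in>product_system \<alpha>. \<forall>y\<in>product_system \<alpha>. \<theta> (ps_mult x y) = ps_mult (\<theta> x) (\<theta> y))"

definition ps_isomorphic ::
  "(real \<Rightarrow> 'a::complex_hilbert_space bop \<Rightarrow> 'a bop) \<Rightarrow>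
   (real \<Rightarrow> 'b::complex_hilbert_space bop \<Rightarrow> 'b bop) \<Rightarrow> bool" where
  "ps_isomorphic \<alpha> \<beta> \<longleftrightarrow> (\<exists>\<theta>. ps_isomorphism \<alpha> \<beta> \<theta>)"

end

theory Submission
  imports Defs
begin

text \<open>
  The product system of \<open>\<alpha>\<close> consists of the intertwiners \<open>T\<close> with \<open>\<alpha>\<^sub>t(A) T = T A\<close>, and it determines \<open>\<alpha>\<close>: by
  normality the ranges of the intertwiners at time \<open>t\<close> span the space, and on \<open>T x\<close> the operator \<open>\<alpha>\<^sub>t(A)\<close>
  acts as \<open>T A x\<close>.

  If \<open>\<theta>\<close> conjugates \<open>\<alpha>\<close> to the perturbation of \<open>\<beta>\<close> by a cocycle \<open>U\<close>, then \<open>T \<mapsto> U\<^sub>t\<^sup>* \<theta>(T)\<close> is an isomorphism of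
  product systems.  The algebra is direct; Borel measurability holds because star isomorphisms are
  implemented by unitaries (\<open>star_iso_imp_spatial\<close>) and because the weak operator \<open>\<sigma>\<close>-algebra is generated
  by matrix coefficients (\<open>measurable_op_borelI\<close>).

  Conversely, let \<open>\<upsilon>\<^sub>t\<close> be the unitaries between the fibers of two isomorphic product systems and \<open>W\<close> any
  unitary between the two spaces, which exists as both are separable and infinite-dimensional.
  There is a unique unitary \<open>U\<^sub>t\<close> with \<open>U\<^sub>t T x = W\<^sup>* \<upsilon>\<^sub>t(T) W x\<close> for all intertwiners \<open>T\<close>, because both sides have
  the same inner products and span (\<open>exists_unitary_extension\<close>).  These unitaries satisfy the cocycle
  identity, and the perturbation of \<open>\<alpha>\<close> by them is \<open>\<beta>\<close> conjugated by \<open>W\<close>.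

  The remaining point is strong continuity of \<open>U\<close>, of which only measurability is visible.  For fixed
  vectors \<open>u, v\<close> the operators \<open>x \<mapsto> \<alpha>\<^sub>t(|x\<rangle>\<langle>u|) v\<close> form a weakly continuous section of the product system of
  \<open>\<alpha>\<close>, whose image under the isomorphism is measurable; every vector is a sum of vectors in the ranges
  of such intertwiners (\<open>intertwiner_expansion\<close>), so \<open>U\<close> is weakly measurable.  A measurable cocycle is then
  continuous by a Steinhaus argument: two times at small distance \<open>h\<close> at which \<open>U\<close> takes nearly the same
  value at some vector force \<open>U\<^sub>h\<close> to be near \<open>1\<close>, provided \<open>\<alpha>\<^sub>h(V)\<close> is close to \<open>V\<close> uniformly in the unitary
  \<open>V\<close>; this uniformity comes again from the intertwiners, which approach \<open>1\<close> as \<open>h\<close> tends to \<open>0\<close>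
  (\<open>E0_semigroup_uniform_limit\<close>).
\<close>

section \<open>Complex inner products\<close>

lemma cinner_add_right: "cinner z (x + y) = cinner z x + cinner z y"
  by (metis cinner_add_left cinner_commute complex_cnj_add)

lemma cinner_scaleC_right: "cinner y (c *\<^sub>C x) = cnj c * cinner y x"
  by (metis cinner_scaleC_left cinner_commute complex_cnj_mult)

lemma cinner_zero_left [simp]: "cinner 0 x = 0"
  using cinner_add_left[of 0 0 x] by simp

lemma cinner_zero_right [simp]: "cinner x 0 = 0"
  using cinner_add_right[of x 0 0] by simp

lemma cinner_minus_left: "cinner (- x) y = - cinner x y"
  using cinner_add_left[of x "- x" y] by (simp add: add_eq_0_iff)

lemma cinner_minus_right: "cinner y (- x) = - cinner y x"
  using cinner_add_right[of y x "- x"] by (simp add: add_eq_0_iff)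

lemma cinner_diff_left: "cinner (x - y) z = cinner x z - cinner y z"
  using cinner_add_left[of x "- y" z] by (simp add: cinner_minus_left)

lemma cinner_diff_right: "cinner z (x - y) = cinner z x - cinner z y"
  using cinner_add_right[of z x "- y"] by (simp add: cinner_minus_right)

lemma cinner_sum_left: "cinner (sum f S) y = (\<Sum>i\<in>S. cinner (f i) y)"
  by (induction S rule: infinite_finite_induct) (simp_all add: cinner_add_left)

lemma cinner_sum_right: "cinner y (sum f S) = (\<Sum>i\<in>S. cinner y (f i))"
  by (induction S rule: infinite_finite_induct) (simp_all add: cinner_add_right)

lemma cinner_self: "cinner x x = complex_of_real ((norm x)\<^sup>2)"
proof -
  have "Im (cinner x x) = 0"
    using arg_cong[OF cinner_commute[of x x], of Im] by simp
  then show ?thesis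
    by (simp add: complex_eq_iff power2_norm_eq_inner inner_eq_Re_cinner del: of_real_power)
qed

lemma Re_cinner_self: "Re (cinner x x) = (norm x)\<^sup>2"
  by (simp add: cinner_self del: of_real_power)

lemma cinner_self_eq_0 [simp]: "cinner x x = 0 \<longleftrightarrow> x = 0"
  by (simp add: cinner_self)

lemma scaleC_zero_left [simp]: "0 *\<^sub>C (x::'a::complex_vector) = 0"
  using scaleC_add_left[of 0 0 x] by simp

lemma scaleC_zero_right [simp]: "c *\<^sub>C (0::'a::complex_vector) = 0"
  using scaleC_add_right[of c "0::'a" 0] by simp

lemma norm_scaleC: "norm (c *\<^sub>C (x::'a::complex_hilbert_space)) = cmod c * norm x"
proof -
  have "complex_of_real ((norm (c *\<^sub>C x))\<^sup>2) = c * cnj c * complex_of_real ((norm x)\<^sup>2)"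
    by (simp only: cinner_self[symmetric] cinner_scaleC_left cinner_scaleC_right mult_ac)
  also have "\<dots> = complex_of_real ((cmod c * norm x)\<^sup>2)"
    by (simp add: complex_norm_square[symmetric] power_mult_distrib)
  finally have "(norm (c *\<^sub>C x))\<^sup>2 = (cmod c * norm x)\<^sup>2"
    by (simp only: of_real_eq_iff)
  then show ?thesis by (simp add: power2_eq_iff_nonneg)
qed

lemma cmod_cinner_le: "cmod (cinner x y) \<le> norm x * norm y"
proof (cases "cinner x y = 0")
  case False
  \<comment> \<open>Rotating \<open>x\<close> by a phase makes the inner product real and positive.\<close>
  define c where "c = cnj (cinner x y) / cmod (cinner x y)"
  have c: "cmod c = 1" using False by (simp add: c_def norm_divide)
  have "cinner (c *\<^sub>C x) y = cmod (cinner x y)"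
    using False by (simp add: c_def cinner_scaleC_left complex_norm_square[symmetric]
        power2_eq_square mult.commute)
  then have "cmod (cinner x y) = inner (c *\<^sub>C x) y"
    by (simp add: inner_eq_Re_cinner)
  also have "\<dots> \<le> norm (c *\<^sub>C x) * norm y" by (rule norm_cauchy_schwarz)
  finally show ?thesis by (simp add: norm_scaleC c)
qed simp

lemma scaleR_cinner_left: "cinner (r *\<^sub>R x) y = r *\<^sub>R cinner x y"
  by (simp add: scaleR_scaleC cinner_scaleC_left scaleR_conv_of_real)

lemma scaleR_cinner_right: "cinner x (r *\<^sub>R y) = r *\<^sub>R cinner x y"
  by (simp add: scaleR_scaleC cinner_scaleC_right scaleR_conv_of_real)

lemma bounded_bilinear_cinner: "bounded_bilinear cinner"
  by unfold_locales
    (auto simp: cinner_add_left cinner_add_right scaleR_cinner_left scaleR_cinner_right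
      intro!: exI[of _ 1] cmod_cinner_le)

lemmas tendsto_cinner = bounded_bilinear.tendsto[OF bounded_bilinear_cinner]
lemmas bounded_linear_cinner_left = bounded_bilinear.bounded_linear_left[OF bounded_bilinear_cinner]
lemmas bounded_linear_cinner_right = bounded_bilinear.bounded_linear_right[OF bounded_bilinear_cinner]

lemma cinner_eqI: "(\<And>z. cinner x z = cinner y z) \<Longrightarrow> x = y"
  by (metis cinner_diff_left cinner_self_eq_0 eq_iff_diff_eq_0)

lemma cinner_eqI_right: "(\<And>z. cinner z x = cinner z y) \<Longrightarrow> x = y"
  by (metis cinner_eqI cinner_commute)

lemma norm_diff_sq: "(norm (x - y))\<^sup>2 = (norm x)\<^sup>2 - 2 * Re (cinner x y) + (norm y)\<^sup>2"
proof -
  have "Re (cinner y x) = Re (cinner x y)" using cinner_commute[of y x] by simp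
  then have "Re (cinner (x - y) (x - y)) = Re (cinner x x) - 2 * Re (cinner x y) + Re (cinner y y)"
    by (simp add: cinner_diff_left cinner_diff_right)
  then show ?thesis by (simp only: Re_cinner_self)
qed

lemma sq_le_mult_imp_le: "(a::real)\<^sup>2 \<le> a * b \<Longrightarrow> 0 \<le> b \<Longrightarrow> a \<le> b"
  by (cases "a > 0") (auto simp: power2_eq_square)

text \<open>
  Weak convergence without gain of norm is norm convergence, since
  \<open>\<parallel>f - x\<parallel>\<^sup>2 \<le> 2 \<parallel>x\<parallel>\<^sup>2 - 2 Re \<langle>f, x\<rangle>\<close>.  Weak limits of contractions become strong limits this way.
\<close>

lemma weak_tendsto_imp_tendsto:
  fixes f :: "'b \<Rightarrow> 'a::complex_hilbert_space"
  assumes "((\<lambda>n. cinner (f n) x) \<longlongrightarrow> cinner x x) F" and "\<forall>\<^sub>F n in F. norm (f n) \<le> norm x"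
  shows "(f \<longlongrightarrow> x) F"
proof -
  have "((\<lambda>n. 2 * (norm x)\<^sup>2 - 2 * Re (cinner (f n) x)) \<longlongrightarrow> 2 * (norm x)\<^sup>2 - 2 * Re (cinner x x)) F"
    by (intro tendsto_intros assms(1))
  then have l: "((\<lambda>n. 2 * (norm x)\<^sup>2 - 2 * Re (cinner (f n) x)) \<longlongrightarrow> 0) F"
    by (simp only: Re_cinner_self) simp
  have "((\<lambda>n. (norm (f n - x))\<^sup>2) \<longlongrightarrow> 0) F"
  proof (rule tendsto_sandwich[OF _ _ tendsto_const l])
    show "\<forall>\<^sub>F n in F. (norm (f n - x))\<^sup>2 \<le> 2 * (norm x)\<^sup>2 - 2 * Re (cinner (f n) x)"
      using assms(2)
    proof eventually_elim
      case (elim n)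
      then have "(norm (f n))\<^sup>2 \<le> (norm x)\<^sup>2" by (simp add: power_mono)
      then show ?case by (simp add: norm_diff_sq)
    qed
  qed simp
  then have "((\<lambda>n. norm (f n - x)) \<longlongrightarrow> 0) F"
    using tendsto_real_sqrt[of "\<lambda>n. (norm (f n - x))\<^sup>2" 0 F] by simp
  then show ?thesis by (simp add: tendsto_norm_zero_iff LIM_zero_iff)
qed

section \<open>The Riesz representation and adjoints\<close>

text \<open>
  The representing vector of \<open>f\<close> is the minimiser of \<open>\<parallel>x\<parallel>\<^sup>2 - 2 f x\<close>.  The parallelogram law
  makes every minimising sequence Cauchy, and the first variation at the minimum is the claim.
\<close>

lemma riesz_representation:
  fixes f :: "'a::{real_inner,banach} \<Rightarrow> real"
  assumes "bounded_linear f"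
  obtains z where "\<And>x. f x = inner x z"
proof -
  interpret f: bounded_linear f by fact
  define J where "J x = (norm x)\<^sup>2 - 2 * f x" for x
  obtain M where M: "\<And>x. \<bar>f x\<bar> \<le> norm x * M"
    using f.bounded by auto
  have below: "- (M\<^sup>2) \<le> J x" for x
  proof -
    have "f x \<le> norm x * M" using M[of x] by linarith
    moreover have "0 \<le> (norm x - M)\<^sup>2" by simp
    ultimately show ?thesis by (simp add: J_def power2_diff)
  qed
  define I where "I = Inf (range J)"
  have bdd: "bdd_below (range J)" using below by (auto intro!: bdd_belowI)
  have I: "I \<le> J x" for x unfolding I_def by (rule cInf_lower[OF _ bdd]) simp
  have "\<exists>x. J x < I + 1 / (real n + 1)" for n
  proof -
    have "I < I + 1 / (real n + 1)" by simp
    then show ?thesis using cInf_lessD[of "range J" "I + 1 / (real n + 1)"] by (auto simp: I_def)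
  qed
  then obtain X where X: "\<And>n. J (X n) < I + 1 / (real n + 1)" by metis
  have par: "(norm (x - y))\<^sup>2 \<le> 2 * (J x - I) + 2 * (J y - I)" for x y
  proof -
    have "J x + J y = 2 * J ((1/2) *\<^sub>R (x + y)) + (norm (x - y))\<^sup>2 / 2"
      by (simp add: J_def f.add f.scaleR power2_norm_eq_inner inner_add_left inner_add_right
          inner_diff_left inner_diff_right inner_commute[of y x] field_simps)
    then show ?thesis using I[of "(1/2) *\<^sub>R (x + y)"] by simp
  qed
  have "Cauchy X"
  proof (rule metric_CauchyI)
    fix e :: real assume "e > 0"
    then obtain N :: nat where N: "inverse (real (Suc N)) < e\<^sup>2 / 4"
      using reals_Archimedean[of "e\<^sup>2 / 4"] by auto
    have near: "J (X k) < I + e\<^sup>2 / 4" if "N \<le> k" for k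
    proof -
      have "J (X k) < I + 1 / (real k + 1)" by (rule X)
      also have "\<dots> \<le> I + inverse (real (Suc N))"
        using that by (intro add_left_mono) (simp add: field_simps)
      also have "\<dots> < I + e\<^sup>2 / 4" using N by simp
      finally show ?thesis .
    qed
    show "\<exists>M. \<forall>m\<ge>M. \<forall>n\<ge>M. dist (X m) (X n) < e"
    proof (intro exI allI impI)
      fix m n assume "N \<le> m" "N \<le> n"
      then have "(norm (X m - X n))\<^sup>2 < e\<^sup>2"
        using par[of "X m" "X n"] near[of m] near[of n] by argo
      then show "dist (X m) (X n) < e"
        using \<open>e > 0\<close> by (simp add: dist_norm power_less_imp_less_base)
    qed
  qed
  then obtain z where z: "X \<longlonglongrightarrow> z" using convergent_eq_Cauchy by blast
  have "(\<lambda>n. J (X n)) \<longlonglongrightarrow> J z"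
    unfolding J_def by (intro tendsto_intros z f.tendsto)
  moreover have "(\<lambda>n. J (X n)) \<longlonglongrightarrow> I"
  proof (rule tendsto_sandwich[where f = "\<lambda>_. I" and h = "\<lambda>n. I + inverse (real (Suc n))"])
    show "\<forall>\<^sub>F n in sequentially. J (X n) \<le> I + inverse (real (Suc n))"
      using X by (auto simp: less_imp_le divide_inverse add.commute intro!: always_eventually)
    show "(\<lambda>n. I + inverse (real (Suc n))) \<longlonglongrightarrow> I"
      using tendsto_add[OF tendsto_const LIMSEQ_inverse_real_of_nat] by simp
  qed (simp_all add: I)
  ultimately have Jz: "J z = I" by (rule LIMSEQ_unique)
  have "f x = inner x z" for x
  proof -
    define d where "d = inner x z - f x"
    have var: "0 \<le> s\<^sup>2 * (norm x)\<^sup>2 + 2 * s * d" for s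
    proof -
      have "J (z + s *\<^sub>R x) = J z + s\<^sup>2 * (norm x)\<^sup>2 + 2 * s * d"
        by (simp add: J_def d_def f.add f.scaleR power2_norm_eq_inner inner_add_left inner_add_right
          inner_commute[of z x] algebra_simps power2_eq_square[of s])
      then show ?thesis using I[of "z + s *\<^sub>R x"] Jz by simp
    qed
    define N where "N = (norm x)\<^sup>2 + 1"
    have N: "N > 0" by (simp add: N_def add_nonneg_pos)
    \<comment> \<open>The step \<open>s = - d / N\<close> minimises the quadratic bound once \<open>\<parallel>x\<parallel>\<^sup>2\<close> is enlarged to \<open>N > 0\<close>.\<close>
    have "0 \<le> (- d / N)\<^sup>2 * (norm x)\<^sup>2 + 2 * (- d / N) * d" by (rule var)
    also have "\<dots> \<le> (- d / N)\<^sup>2 * N + 2 * (- d / N) * d"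
      by (intro add_right_mono mult_left_mono) (auto simp: N_def)
    also have "\<dots> = - (d\<^sup>2 / N)" using N by (simp add: field_simps power2_eq_square)
    finally have "d\<^sup>2 / N \<le> 0" by simp
    then have "d = 0" using N by (simp add: divide_le_0_iff)
    then show ?thesis by (simp add: d_def)
  qed
  then show ?thesis using that by blast
qed

lemma bounded_linear_apply_op: "bounded_linear (apply_op A)"
  using apply_op[of A] by auto

lemma op_scaleC: "apply_op A (c *\<^sub>C x) = c *\<^sub>C apply_op A x"
  using apply_op[of A] by auto

lemma op_add: "apply_op A (x + y) = apply_op A x + apply_op A y"
  by (simp add: bounded_linear.linear[OF bounded_linear_apply_op] linear_add)

lemma op_diff: "apply_op A (x - y) = apply_op A x - apply_op A y"
  by (simp add: bounded_linear.linear[OF bounded_linear_apply_op] linear_diff)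

lemma op_zero [simp]: "apply_op A 0 = 0"
  by (simp add: bounded_linear.linear[OF bounded_linear_apply_op] linear_0)

lemmas apply_op_simps [simp] =
  times_bop.rep_eq one_bop.rep_eq zero_bop.rep_eq plus_bop.rep_eq minus_bop.rep_eq
  uminus_bop.rep_eq scaleC_bop.rep_eq

lemma apply_op_sum: "apply_op (sum f S) x = (\<Sum>i\<in>S. apply_op (f i) x)"
  by (induction S rule: infinite_finite_induct) simp_all

lemma bop_eqI: "(\<And>x. apply_op A x = apply_op B x) \<Longrightarrow> A = B"
  by (metis apply_op_inject ext)

lemma bop_times_simps:
  fixes A B C :: "'a::complex_hilbert_space bop"
  shows "(A + B) * C = A * C + B * C" "A * (B + C) = A * B + A * C"
    "(c *\<^sub>C A) * B = c *\<^sub>C (A * B)" "A * (c *\<^sub>C B) = c *\<^sub>C (A * B)"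
  by (auto intro!: bop_eqI simp: op_add op_scaleC)

lemma bop_of_function:
  fixes f :: "'a::complex_hilbert_space \<Rightarrow> 'a"
  assumes "\<And>x y. f (x + y) = f x + f y" and "\<And>c x. f (c *\<^sub>C x) = c *\<^sub>C f x"
    and "\<And>x. norm (f x) \<le> norm x * K"
  shows "apply_op (Abs_bop f) = f"
  using assms
  by (intro Abs_bop_inverse) (auto intro!: bounded_linear_intro[of _ K] simp: scaleR_scaleC)

lemma adjoint_ex1:
  "\<exists>!S. \<forall>x y. cinner (apply_op T x) y = cinner x (apply_op S y)"
proof (rule ex_ex1I)
  have "\<exists>z. \<forall>x. cinner (apply_op T x) y = cinner x z" for y
  proof -
    have "bounded_linear (\<lambda>x. inner (apply_op T x) y)"
      by (intro bounded_linear_compose[OF bounded_linear_inner_left] bounded_linear_apply_op)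
    then obtain z where z: "\<And>x. inner (apply_op T x) y = inner x z"
      by (rule riesz_representation) blast
    \<comment> \<open>Only real parts agree so far; evaluating at \<open>\<i>x\<close> yields the imaginary parts.\<close>
    have "cinner (apply_op T x) y = cinner x z" for x
      using z[of x] z[of "\<i> *\<^sub>C x"]
      by (simp add: complex_eq_iff inner_eq_Re_cinner op_scaleC cinner_scaleC_left)
    then show ?thesis by blast
  qed
  then obtain S where S: "\<And>x y. cinner (apply_op T x) y = cinner x (S y)" by metis
  obtain K where K: "\<And>x. norm (apply_op T x) \<le> norm x * K" "0 \<le> K"
    using bounded_linear.nonneg_bounded[OF bounded_linear_apply_op[of T]] by blast
  have "apply_op (Abs_bop S) = S"
  proof (rule bop_of_function)
    show "S (x + y) = S x + S y" for x y
      by (rule cinner_eqI_right) (simp add: S[symmetric] cinner_add_right)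
    show "S (c *\<^sub>C x) = c *\<^sub>C S x" for c x
      by (rule cinner_eqI_right) (simp add: S[symmetric] cinner_scaleC_right)
    show "norm (S y) \<le> norm y * K" for y
    proof (rule sq_le_mult_imp_le)
      have "(norm (S y))\<^sup>2 = Re (cinner (apply_op T (S y)) y)"
        by (simp add: S Re_cinner_self)
      also have "\<dots> \<le> norm (apply_op T (S y)) * norm y"
        using complex_Re_le_cmod cmod_cinner_le order_trans by blast
      also have "\<dots> \<le> norm (S y) * K * norm y" by (intro mult_right_mono K) simp
      finally show "(norm (S y))\<^sup>2 \<le> norm (S y) * (norm y * K)" by (simp add: mult_ac)
    qed (use K in simp)
  qed
  then show "\<exists>S. \<forall>x y. cinner (apply_op T x) y = cinner x (apply_op S y)"
    using S by metis
next
  fix S S'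
  assume "\<forall>x y. cinner (apply_op T x) y = cinner x (apply_op S y)"
    and "\<forall>x y. cinner (apply_op T x) y = cinner x (apply_op S' y)"
  then show "S = S'" by (intro bop_eqI cinner_eqI_right) metis
qed

lemma cinner_adj_right: "cinner x (apply_op (adj T) y) = cinner (apply_op T x) y"
  using theI'[OF adjoint_ex1[of T]] unfolding adj_def by metis

lemma cinner_adj_left: "cinner (apply_op (adj T) x) y = cinner x (apply_op T y)"
  by (metis cinner_adj_right cinner_commute)

lemma adj_eqI: "(\<And>x y. cinner (apply_op T x) y = cinner x (apply_op S y)) \<Longrightarrow> adj T = S"
  by (intro bop_eqI cinner_eqI_right) (metis cinner_adj_right)

lemma adj_times: "adj (A * B) = adj B * adj A"
  by (rule adj_eqI) (simp add: cinner_adj_right)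

lemma adj_adj [simp]: "adj (adj A) = A"
  by (rule adj_eqI) (simp add: cinner_adj_left)

lemma adj_one [simp]: "adj 1 = 1"
  by (rule adj_eqI) simp

section \<open>Orthonormal bases and unitaries between Hilbert spaces\<close>

definition orthonormal_basis :: "(nat \<Rightarrow> 'a::complex_hilbert_space) \<Rightarrow> bool" where
  "orthonormal_basis e \<longleftrightarrow>
     (\<forall>i j. cinner (e i) (e j) = of_bool (i = j)) \<and> (\<forall>x. (\<forall>n. cinner x (e n) = 0) \<longrightarrow> x = 0)"

lemma orthonormal_basis_norm: "orthonormal_basis e \<Longrightarrow> norm (e n) = 1"
  using Re_cinner_self[of "e n"] norm_ge_zero[of "e n"]
  by (auto simp: orthonormal_basis_def power2_eq_1_iff simp del: norm_ge_zero)

lemma norm_sum_orthonormal: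
  assumes "\<forall>i j. cinner (e i) (e j) = of_bool (i = j)" and "finite S"
  shows "(norm (\<Sum>n\<in>S. a n *\<^sub>C e n))\<^sup>2 = (\<Sum>n\<in>S. (cmod (a n))\<^sup>2)"
proof -
  have "cinner (\<Sum>n\<in>S. a n *\<^sub>C e n) (\<Sum>n\<in>S. a n *\<^sub>C e n) = (\<Sum>n\<in>S. a n * cnj (a n))"
  proof -
    have "cinner (a i *\<^sub>C e i) (\<Sum>n\<in>S. a n *\<^sub>C e n) = (\<Sum>n\<in>S. if i = n then a i * cnj (a n) else 0)" for i
      unfolding cinner_sum_right
      by (rule sum.cong) (use assms(1) in \<open>auto simp: cinner_scaleC_left cinner_scaleC_right\<close>)
    then show ?thesis using assms(2) by (simp add: cinner_sum_left)
  qed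
  then have "complex_of_real ((norm (\<Sum>n\<in>S. a n *\<^sub>C e n))\<^sup>2) = complex_of_real (\<Sum>n\<in>S. (cmod (a n))\<^sup>2)"
    by (simp add: cinner_self complex_norm_square[symmetric])
  then show ?thesis by (simp only: of_real_eq_iff)
qed

lemma bessel:
  assumes e: "\<forall>i j. cinner (e i) (e j) = of_bool (i = j)" and "finite S"
  shows "(\<Sum>n\<in>S. (cmod (cinner x (e n)))\<^sup>2) \<le> (norm x)\<^sup>2"
proof -
  let ?p = "\<Sum>n\<in>S. cinner x (e n) *\<^sub>C e n"
  have "cinner x ?p = (\<Sum>n\<in>S. cnj (cinner x (e n)) * cinner x (e n))"
    by (simp add: cinner_sum_right cinner_scaleC_right)
  also have "\<dots> = complex_of_real (\<Sum>n\<in>S. (cmod (cinner x (e n)))\<^sup>2)"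
    unfolding of_real_sum complex_norm_square by (simp add: mult.commute)
  finally have "Re (cinner x ?p) = (norm ?p)\<^sup>2"
    using norm_sum_orthonormal[OF assms, of "\<lambda>n. cinner x (e n)"] by simp
  then have "0 \<le> (norm x)\<^sup>2 - (norm ?p)\<^sup>2"
    using norm_diff_sq[of x ?p] zero_le_power2[of "norm (x - ?p)"] by linarith
  then show ?thesis using norm_sum_orthonormal[OF assms, of "\<lambda>n. cinner x (e n)"] by simp
qed

text \<open>
  By orthonormality the blocks of the vector series have the norms of the blocks of the scalar
  series, so Cauchy's criterion carries over.
\<close>

lemma riesz_fischer:
  assumes e: "orthonormal_basis (e :: nat \<Rightarrow> 'a::complex_hilbert_space)"
    and "summable (\<lambda>n. (cmod (a n))\<^sup>2)"
  shows "summable (\<lambda>n. a n *\<^sub>C e n)"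
  unfolding summable_Cauchy
proof (intro allI impI)
  fix r :: real assume r: "r > 0"
  then obtain N where N: "\<And>m n. m \<ge> N \<Longrightarrow> norm (\<Sum>k=m..<n. (cmod (a k))\<^sup>2) < r\<^sup>2"
    using assms(2) unfolding summable_Cauchy by (meson zero_less_power)
  have "norm (\<Sum>k=m..<n. a k *\<^sub>C e k) < r" if "m \<ge> N" for m n
  proof -
    have "(norm (\<Sum>k=m..<n. a k *\<^sub>C e k))\<^sup>2 < r\<^sup>2"
      using N[OF that, of n] e norm_sum_orthonormal[of e "{m..<n}" a]
      by (simp add: orthonormal_basis_def sum_nonneg)
    then show ?thesis using r by (simp add: power_less_imp_less_base)
  qed
  then show "\<exists>N. \<forall>m\<ge>N. \<forall>n. norm (\<Sum>k=m..<n. a k *\<^sub>C e k) < r" by blast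
qed

lemma summable_coefficients:
  assumes "orthonormal_basis e"
  shows "summable (\<lambda>n. (cmod (cinner x (e n)))\<^sup>2)"
  using bessel[of e "{..<n}" x for n] assms
  by (intro summableI_nonneg_bounded[of _ "(norm x)\<^sup>2"]) (auto simp: orthonormal_basis_def)

lemma cinner_sums_coefficient:
  assumes "orthonormal_basis e" and "(\<lambda>n. a n *\<^sub>C e n) sums x"
  shows "cinner x (e k) = a k"
proof -
  have "(\<lambda>n. cinner (a n *\<^sub>C e n) (e k)) sums cinner x (e k)"
    by (rule bounded_linear.sums[OF bounded_linear_cinner_left assms(2)])
  moreover have "(\<lambda>n. cinner (a n *\<^sub>C e n) (e k)) = (\<lambda>n. if n = k then a n else 0)"
    using assms(1) by (auto simp: orthonormal_basis_def cinner_scaleC_left)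
  ultimately show ?thesis
    using sums_single[of k a] sums_unique2 by metis
qed

lemma orthonormal_expansion:
  assumes e: "orthonormal_basis e"
  shows "(\<lambda>n. cinner x (e n) *\<^sub>C e n) sums x"
proof -
  obtain y where y: "(\<lambda>n. cinner x (e n) *\<^sub>C e n) sums y"
    using riesz_fischer[OF e summable_coefficients[OF e]] summable_def by blast
  have "cinner (x - y) (e n) = 0" for n
    by (simp add: cinner_diff_left cinner_sums_coefficient[OF e y])
  then have "x - y = 0" using e unfolding orthonormal_basis_def by blast
  then show ?thesis using y by simp
qed

text \<open>
  A maximal orthonormal set is countable because its members are a fixed distance apart, and
  infinite because a finite one would span.
\<close>

lemma exists_orthonormal_basis:
  assumes "separable_space (euclidean :: 'a::complex_hilbert_space topology)"
    and inf: "infinite_dimensional TYPE('a::complex_hilbert_space)"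
  obtains e :: "nat \<Rightarrow> 'a::complex_hilbert_space" where "orthonormal_basis e"
proof -
  define ON where "ON = {B :: 'a set. \<forall>x\<in>B. \<forall>y\<in>B. cinner x y = of_bool (x = y)}"
  have "\<exists>B\<in>ON. \<forall>X\<in>ON. B \<subseteq> X \<longrightarrow> X = B"
  proof (rule subset_Zorn_nonempty)
    show "ON \<noteq> {}" unfolding ON_def by (auto intro: exI[of _ "{}"])
  next
    fix C assume C: "C \<noteq> {}" "subset.chain ON C"
    show "\<Union>C \<in> ON" unfolding ON_def mem_Collect_eq
    proof (intro ballI)
      fix x y assume "x \<in> \<Union>C" "y \<in> \<Union>C"
      then obtain X Y where XY: "X \<in> C" "x \<in> X" "Y \<in> C" "y \<in> Y" by blast
      then obtain Z where "Z \<in> C" "x \<in> Z" "y \<in> Z"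
        using C(2) unfolding subset_chain_def by blast
      then show "cinner x y = of_bool (x = y)"
        using C(2) unfolding subset_chain_def ON_def by blast
    qed
  qed
  then obtain B where B: "B \<in> ON" and max: "\<And>X. X \<in> ON \<Longrightarrow> B \<subseteq> X \<Longrightarrow> X = B" by blast
  have ortho: "\<And>x y. x \<in> B \<Longrightarrow> y \<in> B \<Longrightarrow> cinner x y = of_bool (x = y)"
    using B by (simp add: ON_def)
  have total: "x = 0" if x: "\<And>b. b \<in> B \<Longrightarrow> cinner x b = 0" for x
  proof (rule ccontr)
    assume "x \<noteq> 0"
    define y where "y = complex_of_real (1 / norm x) *\<^sub>C x"
    have "norm y = 1"
      using \<open>x \<noteq> 0\<close> by (simp add: y_def norm_scaleC norm_divide)
    then have "cinner y y = 1" by (simp add: cinner_self)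
    have yb: "cinner y b = 0" if "b \<in> B" for b
      using x[OF that] by (simp add: y_def cinner_scaleC_left)
    have yb': "cinner b y = 0" if "b \<in> B" for b
      using yb[OF that] cinner_commute[of b y] by simp
    have "y \<notin> B"
    proof
      assume "y \<in> B"
      from yb[OF this] \<open>cinner y y = 1\<close> show False by simp
    qed
    have "insert y B \<in> ON"
      unfolding ON_def mem_Collect_eq
    proof (intro ballI)
      fix c d assume "c \<in> insert y B" "d \<in> insert y B"
      then consider "c = y" "d = y" | "c = y" "d \<in> B" | "c \<in> B" "d = y" | "c \<in> B" "d \<in> B"
        by blast
      then show "cinner c d = of_bool (c = d)"
      proof cases
        case 1
        then show ?thesis by (simp only: \<open>cinner y y = 1\<close> simp_thms of_bool_eq)
      next
        case 2
        moreover from this have "y \<noteq> d" using \<open>y \<notin> B\<close> by metis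
        ultimately show ?thesis by (simp only: yb simp_thms of_bool_eq)
      next
        case 3
        moreover from this have "c \<noteq> y" using \<open>y \<notin> B\<close> by metis
        ultimately show ?thesis by (simp only: yb' simp_thms of_bool_eq)
      qed (rule ortho)
    qed
    then have "insert y B = B" by (rule max) (rule subset_insertI)
    then have "y \<in> B" by (rule subst) (rule insertI1)
    then show False using \<open>y \<notin> B\<close> by (rule notE[rotated])
  qed
  have "infinite B"
  proof
    assume fin: "finite B"
    interpret vs: module "scaleC :: complex \<Rightarrow> 'a \<Rightarrow> 'a"
      by unfold_locales (simp_all add: scaleC_add_right scaleC_add_left scaleC_scaleC scaleC_one)
    have "x \<in> vs.span B" for x
    proof -
      have "x - (\<Sum>b\<in>B. cinner x b *\<^sub>C b) = 0"
      proof (rule total)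
        fix c assume c: "c \<in> B"
        have "cinner (\<Sum>b\<in>B. cinner x b *\<^sub>C b) c = (\<Sum>b\<in>B. if b = c then cinner x b else 0)"
          unfolding cinner_sum_left by (rule sum.cong) (auto simp: cinner_scaleC_left ortho c)
        then show "cinner (x - (\<Sum>b\<in>B. cinner x b *\<^sub>C b)) c = 0"
          using fin c by (simp add: cinner_diff_left)
      qed
      then have "x = (\<Sum>b\<in>B. cinner x b *\<^sub>C b)" by (rule eq_iff_diff_eq_0[THEN iffD2])
      moreover have "(\<Sum>b\<in>B. cinner x b *\<^sub>C b) \<in> vs.span B"
        by (intro vs.span_sum vs.span_scale vs.span_base)
      ultimately show ?thesis by (simp only:)
    qed
    then show False using inf fin unfolding infinite_dimensional_def by blast
  qed
  moreover have "countable B"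
  proof -
    obtain D :: "'a set" where D: "countable D" "closure D = UNIV"
      using assms(1) by (auto simp: separable_space_def)
    have "\<exists>d\<in>D. dist d b < 1 / 2" for b
      using D(2) closure_approachable[THEN iffD1, rule_format, of b D "1 / 2"] by simp
    then obtain d where d: "\<And>b. d b \<in> D" "\<And>b. dist (d b) b < 1 / 2" by metis
    have "inj_on d B"
    proof (rule inj_onI, rule ccontr)
      fix b c assume *: "b \<in> B" "c \<in> B" "d b = d c" "b \<noteq> c"
      have "dist b c < 1"
        using d(2)[of b] d(2)[of c] dist_triangle[of b c "d b"] *(3) by (simp add: dist_commute)
      then have "(norm (b - c))\<^sup>2 < 1" by (simp add: dist_norm power_less_one_iff)
      moreover have "(norm (b - c))\<^sup>2 = 2"
        using norm_diff_sq[of b c] Re_cinner_self[of b] Re_cinner_self[of c] ortho * by simp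
      ultimately show False by simp
    qed
    then show ?thesis using d(1) D(1) by (meson countable_subset image_subsetI countable_image_inj_on)
  qed
  ultimately obtain e :: "nat \<Rightarrow> 'a" where e: "bij_betw e UNIV B"
    using bij_betw_from_nat_into by blast
  have "orthonormal_basis e"
    unfolding orthonormal_basis_def
  proof (intro conjI allI impI)
    show "cinner (e i) (e j) = of_bool (i = j)" for i j
      using e ortho[of "e i" "e j"] by (auto simp: bij_betw_def inj_eq)
    show "x = 0" if "\<forall>n. cinner x (e n) = 0" for x
      using total[of x] that e by (auto simp: bij_betw_def)
  qed
  then show ?thesis by (rule that)
qed

definition hilbert_iso :: "('a::complex_hilbert_space \<Rightarrow> 'b::complex_hilbert_space) \<Rightarrow> bool" where
  "hilbert_iso W \<longleftrightarrow> surj W \<and> (\<forall>x y. cinner (W x) (W y) = cinner x y)"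

lemma hilbert_iso_norm: "hilbert_iso W \<Longrightarrow> norm (W x) = norm x"
  using Re_cinner_self[of "W x"] Re_cinner_self[of x]
  by (simp add: hilbert_iso_def)

text \<open>
  Every vector of the target has the form \<open>W z\<close>, so \<open>W (x + y)\<close> and \<open>W (c x)\<close> are determined by their
  inner products with such vectors, which \<open>W\<close> preserves.
\<close>

lemma hilbert_iso_linear:
  assumes "hilbert_iso W"
  shows "W (x + y) = W x + W y" and "W (c *\<^sub>C x) = c *\<^sub>C W x"
proof -
  have ex: "\<exists>z'. z = W z'" for z using assms by (auto simp: hilbert_iso_def surj_def)
  have i: "cinner (W x) (W y) = cinner x y" for x y using assms by (simp add: hilbert_iso_def)
  show "W (x + y) = W x + W y"
  proof (rule cinner_eqI)
    show "cinner (W (x + y)) z = cinner (W x + W y) z" for z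
      using ex[of z] by (auto simp: i cinner_add_left)
  qed
  show "W (c *\<^sub>C x) = c *\<^sub>C W x"
  proof (rule cinner_eqI)
    show "cinner (W (c *\<^sub>C x)) z = cinner (c *\<^sub>C W x) z" for z
      using ex[of z] by (auto simp: i cinner_scaleC_left)
  qed
qed

lemma hilbert_iso_inj: "hilbert_iso W \<Longrightarrow> inj W"
  by (rule injI) (metis cinner_eqI hilbert_iso_def)

lemma hilbert_iso_inv:
  assumes "hilbert_iso W"
  shows "hilbert_iso (inv W)" and "W (inv W y) = y" and "inv W (W x) = x"
    and "cinner (W x) y = cinner x (inv W y)" and "cinner y (W x) = cinner (inv W y) x"
proof -
  have s: "surj W" using assms by (simp add: hilbert_iso_def)
  have j: "inj W" by (rule hilbert_iso_inj[OF assms])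
  show 1: "W (inv W y) = y" for y by (rule surj_f_inv_f[OF s])
  show "inv W (W x) = x" by (rule inv_f_f[OF j])
  have i: "cinner (W x) (W y) = cinner x y" for x y using assms by (simp add: hilbert_iso_def)
  show "hilbert_iso (inv W)"
    using inj_imp_surj_inv[OF j] i[of "inv W x" "inv W y" for x y] by (simp add: hilbert_iso_def 1)
  show "cinner (W x) y = cinner x (inv W y)" using i[of x "inv W y"] by (simp add: 1)
  show "cinner y (W x) = cinner (inv W y) x" using i[of "inv W y" x] by (simp add: 1)
qed

text \<open>
  Coefficients in one basis are used as coefficients in the other; Riesz-Fischer gives convergence
  and, applied backwards, surjectivity.
\<close>

lemma exists_hilbert_iso:
  assumes e: "orthonormal_basis (e :: nat \<Rightarrow> 'a::complex_hilbert_space)"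
    and f: "orthonormal_basis (f :: nat \<Rightarrow> 'b::complex_hilbert_space)"
  obtains W :: "'a::complex_hilbert_space \<Rightarrow> 'b::complex_hilbert_space" where "hilbert_iso W"
proof -
  have "\<exists>y. (\<lambda>n. cinner x (e n) *\<^sub>C f n) sums y" for x
    using riesz_fischer[OF f summable_coefficients[OF e]] summable_def by blast
  then obtain W where W: "\<And>x. (\<lambda>n. cinner x (e n) *\<^sub>C f n) sums W x" by metis
  have "cinner (W x) (W y) = cinner x y" for x y
  proof -
    have "(\<lambda>n. cinner (cinner x (e n) *\<^sub>C f n) (W y)) sums cinner (W x) (W y)"
      by (rule bounded_linear.sums[OF bounded_linear_cinner_left W])
    moreover have "cinner (f n) (W y) = cinner (e n) y" for n
      using cinner_sums_coefficient[OF f W, of y n] by (metis cinner_commute)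
    ultimately have "(\<lambda>n. cinner (cinner x (e n) *\<^sub>C e n) y) sums cinner (W x) (W y)"
      by (simp add: cinner_scaleC_left)
    moreover have "(\<lambda>n. cinner (cinner x (e n) *\<^sub>C e n) y) sums cinner x y"
      by (rule bounded_linear.sums[OF bounded_linear_cinner_left orthonormal_expansion[OF e]])
    ultimately show ?thesis by (rule sums_unique2)
  qed
  moreover have "\<exists>x. y = W x" for y
  proof -
    obtain x where x: "(\<lambda>n. cinner y (f n) *\<^sub>C e n) sums x"
      using riesz_fischer[OF e summable_coefficients[OF f]] summable_def by blast
    have "(\<lambda>n. cinner y (f n) *\<^sub>C f n) sums W x"
      using W[of x] by (simp add: cinner_sums_coefficient[OF e x])
    then show ?thesis using orthonormal_expansion[OF f] sums_unique2 by blast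
  qed
  ultimately show ?thesis by (intro that[of W]) (auto simp: hilbert_iso_def surj_def)
qed

section \<open>Spatial isomorphisms and rank one operators\<close>

definition spatial ::
  "('a::complex_hilbert_space \<Rightarrow> 'b::complex_hilbert_space) \<Rightarrow> 'a bop \<Rightarrow> 'b bop" where
  "spatial W A = Abs_bop (\<lambda>y. W (apply_op A (inv W y)))"

lemma apply_spatial:
  assumes "hilbert_iso W"
  shows "apply_op (spatial W A) y = W (apply_op A (inv W y))"
proof -
  obtain K where K: "\<And>x. norm (apply_op A x) \<le> norm x * K"
    using bounded_linear.nonneg_bounded[OF bounded_linear_apply_op[of A]] by blast
  note inv = hilbert_iso_inv(1)[OF assms]
  have "apply_op (spatial W A) = (\<lambda>y. W (apply_op A (inv W y)))"
    unfolding spatial_def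
    by (rule bop_of_function[where K = K])
      (use K[of "inv W y" for y] in \<open>simp_all add: hilbert_iso_linear[OF assms] hilbert_iso_linear[OF inv]
        hilbert_iso_norm[OF assms] hilbert_iso_norm[OF inv] op_add op_scaleC\<close>)
  then show ?thesis by simp
qed

lemma spatial_inv:
  assumes "hilbert_iso W"
  shows "spatial W (spatial (inv W) B) = B" and "spatial (inv W) (spatial W A) = A"
  using assms hilbert_iso_inv[OF assms]
  by (auto intro!: bop_eqI simp: apply_spatial inv_inv_eq hilbert_iso_inj bij_def hilbert_iso_def)

lemma vector_space_scaleC: "vector_space (scaleC :: complex \<Rightarrow> 'a::complex_vector \<Rightarrow> 'a)"
  by unfold_locales (simp_all add: scaleC_add_right scaleC_add_left scaleC_scaleC scaleC_one)

lemma linear_scaleC_iff: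
  fixes f :: "'a::complex_vector \<Rightarrow> 'b::complex_vector"
  shows "Vector_Spaces.linear scaleC scaleC f \<longleftrightarrow>
     (\<forall>A B. f (A + B) = f A + f B) \<and> (\<forall>c A. f (c *\<^sub>C A) = c *\<^sub>C f A)"
  by (simp add: Vector_Spaces.linear_iff vector_space_scaleC)

lemma star_homD:
  assumes "star_hom \<phi>"
  shows "\<phi> (A + B) = \<phi> A + \<phi> B" "\<phi> (c *\<^sub>C A) = c *\<^sub>C \<phi> A" "\<phi> (A * B) = \<phi> A * \<phi> B"
    "\<phi> (adj A) = adj (\<phi> A)"
  using assms by (auto simp: star_hom_def linear_scaleC_iff)

lemma star_hom_zero: "star_hom \<phi> \<Longrightarrow> \<phi> 0 = 0"
  using star_homD(1)[of \<phi> 0 0] by simp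

lemma star_hom_sum: "star_hom \<phi> \<Longrightarrow> \<phi> (sum f S) = (\<Sum>i\<in>S. \<phi> (f i))"
  by (induction S rule: infinite_finite_induct) (simp_all add: star_hom_zero star_homD)

lemma star_iso_spatial:
  assumes W: "hilbert_iso W"
  shows "star_iso (spatial W)"
proof -
  note s = apply_spatial[OF W] and l = hilbert_iso_linear[OF W]
  have "spatial W (adj A) = adj (spatial W A)" for A
    by (rule sym, rule adj_eqI) (simp add: s hilbert_iso_inv(4,5)[OF W] cinner_adj_right)
  moreover have "bij (spatial W)"
    by (rule bijI'[where ?'a = "'a bop"]) (metis spatial_inv[OF W])+
  ultimately show ?thesis
    unfolding star_iso_def star_hom_def linear_scaleC_iff
    by (auto intro!: bop_eqI simp: s l hilbert_iso_inv[OF W])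
qed

text \<open>
  The operator \<open>|x\<rangle>\<langle>y|\<close>.
\<close>

lift_definition rank1 :: "'a::complex_hilbert_space \<Rightarrow> 'a \<Rightarrow> 'a bop" is
  "\<lambda>x y z. cinner z y *\<^sub>C x"
proof (intro conjI allI)
  fix x y :: 'a
  show "bounded_linear (\<lambda>z. cinner z y *\<^sub>C x)"
    by (rule bounded_linear_intro[where K = "norm x * norm y"])
      (auto simp: cinner_add_left scaleC_add_left scaleR_scaleC cinner_scaleC_left scaleC_scaleC
        norm_scaleC intro: order_trans[OF mult_right_mono[OF cmod_cinner_le]])
qed (simp add: cinner_scaleC_left scaleC_scaleC)

lemmas apply_rank1 [simp] = rank1.rep_eq

lemma times_rank1: "A * rank1 x y = rank1 (apply_op A x) y"
  by (rule bop_eqI) (simp add: op_scaleC)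

lemma rank1_times_rank1: "rank1 x y * rank1 z w = cinner z y *\<^sub>C rank1 x w"
  by (rule bop_eqI) (simp add: scaleC_scaleC cinner_scaleC_left mult.commute)

lemma adj_rank1: "adj (rank1 x y) = rank1 y x"
  by (rule adj_eqI) (simp add: cinner_scaleC_left cinner_scaleC_right mult.commute,
      metis cinner_commute mult.commute)

lemma rank1_add: "rank1 (x + y) z = rank1 x z + rank1 y z"
  by (rule bop_eqI) (simp add: scaleC_add_right)

lemma rank1_scaleC: "rank1 (c *\<^sub>C x) z = c *\<^sub>C rank1 x z"
  by (rule bop_eqI) (simp add: scaleC_scaleC mult.commute)

section \<open>The Borel structure of the weak operator topology\<close>

lemma measurable_matrix_coefficient:
  "(\<lambda>A. cinner (apply_op A x) y) \<in> borel_measurable op_borel"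
proof (rule borel_measurableI)
  fix G :: "complex set" assume "open G"
  then have "openin weak_operator_topology {A. cinner (apply_op A x) y \<in> G}"
    unfolding weak_operator_topology_def openin_topology_generated_by_iff
    by (intro generate_topology_on.Basis) blast
  then show "(\<lambda>A. cinner (apply_op A x) y) -` G \<inter> space op_borel \<in> sets op_borel"
    unfolding op_borel_def by (simp add: vimage_def sigma_sets.Basic)
qed

lemma space_op_borel [simp]: "space op_borel = UNIV"
  by (simp add: op_borel_def)

text \<open>
  A norm bound phrased through matrix coefficients, so that it can be tested on a dense set and
  defines measurable sets of operators.
\<close>

definition op_bounded :: "real \<Rightarrow> 'a::complex_hilbert_space bop \<Rightarrow> bool" where
  "op_bounded r A \<longleftrightarrow> (\<forall>x y. cmod (cinner (apply_op A x) y) \<le> r * norm x * norm y)"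

lemma ex_op_bounded: "\<exists>n::nat. op_bounded (real n) A"
proof -
  obtain K where K: "\<And>x. norm (apply_op A x) \<le> norm x * K" "0 \<le> K"
    using bounded_linear.nonneg_bounded[OF bounded_linear_apply_op[of A]] by blast
  obtain n :: nat where n: "K \<le> real n" using real_arch_simple by blast
  have "cmod (cinner (apply_op A x) y) \<le> real n * norm x * norm y" for x y
  proof -
    have "cmod (cinner (apply_op A x) y) \<le> norm (apply_op A x) * norm y" by (rule cmod_cinner_le)
    also have "\<dots> \<le> (norm x * K) * norm y" by (intro mult_right_mono K) simp
    also have "\<dots> \<le> (norm x * real n) * norm y" by (intro mult_right_mono mult_left_mono n) simp_all
    finally show ?thesis by (simp add: mult_ac)
  qed
  then show ?thesis unfolding op_bounded_def by blast
qed

lemma op_bounded_dense: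
  assumes D: "closure D = UNIV"
    and le: "\<And>x y. x \<in> D \<Longrightarrow> y \<in> D \<Longrightarrow> cmod (cinner (apply_op A x) y) \<le> r * norm x * norm y"
  shows "op_bounded r A"
proof -
  have *: "cmod (cinner (apply_op A x) y) \<le> r * norm x * norm y" if y: "y \<in> D" for x y
  proof -
    have "closed {x. cmod (cinner (apply_op A x) y) \<le> r * norm x * norm y}"
      by (intro closed_Collect_le continuous_intros
          bounded_linear.continuous_on[OF bounded_linear_cinner_left]
          bounded_linear.continuous_on[OF bounded_linear_apply_op])
    then have "closure D \<subseteq> {x. cmod (cinner (apply_op A x) y) \<le> r * norm x * norm y}"
      using le[OF _ y] by (intro closure_minimal) auto
    then show ?thesis using D by auto
  qed
  have "cmod (cinner (apply_op A x) y) \<le> r * norm x * norm y" for x y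
  proof -
    have "closed {y. cmod (cinner (apply_op A x) y) \<le> r * norm x * norm y}"
      by (intro closed_Collect_le continuous_intros
          bounded_linear.continuous_on[OF bounded_linear_cinner_right])
    then have "closure D \<subseteq> {y. cmod (cinner (apply_op A x) y) \<le> r * norm x * norm y}"
      using * by (intro closure_minimal) auto
    then show ?thesis using D by auto
  qed
  then show ?thesis by (simp add: op_bounded_def)
qed

lemma small_multiple:
  fixes c :: real assumes "0 \<le> c" "0 < e"
  obtains d where "0 < d" "c * d < e"
proof
  show "0 < e / (c + 1)" using assms by simp
  show "c * (e / (c + 1)) < e" using assms by (simp add: field_simps)
qed



text \<open>
  The \<open>\<sigma>\<close>-algebra of the weak operator topology is generated by matrix coefficients.  This is not
  immediate, because the topology need not have a countable base.  Its restriction to a norm ball has one,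
  built from the matrix coefficients at a dense sequence of vectors, and countably many balls
  cover all operators; so every open set is a countable union of basic sets cut down to balls.
\<close>

lemma measurable_op_borelI:
  fixes f :: "'x \<Rightarrow> 'a::complex_hilbert_space bop"
  assumes sep: "separable_space (euclidean :: 'a topology)"
    and f: "\<And>x y. (\<lambda>p. cinner (apply_op (f p) x) y) \<in> borel_measurable M"
  shows "f \<in> M \<rightarrow>\<^sub>M op_borel"
proof -
  obtain D :: "'a set" where D: "countable D" "closure D = UNIV"
    using sep by (auto simp: separable_space_def)
  have "D \<noteq> {}" using D(2) by (metis closure_empty empty_not_UNIV)
  define d where "d = from_nat_into D"
  have d: "range d = D" unfolding d_def by (rule range_from_nat_into[OF \<open>D \<noteq> {}\<close> D(1)])
  have near: "\<exists>i. norm (x - d i) < r" if "r > 0" for x r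
  proof -
    have "x \<in> closure D" by (simp only: D(2) UNIV_I)
    then obtain y where y: "y \<in> D" "dist y x < r"
      using closure_approachable[THEN iffD1, rule_format, of x D r] \<open>r > 0\<close> by blast
    from y(1) obtain i where "y = d i" unfolding d[symmetric] by (rule rangeE)
    with y(2) show ?thesis by (metis dist_norm norm_minus_commute)
  qed
  obtain \<B> :: "complex set set" where \<B>: "countable \<B>" "topological_basis \<B>"
    using ex_countable_basis by (elim exE conjE)
  have "\<B> \<noteq> {}" by (rule topological_basisE[OF \<B>(2) open_UNIV UNIV_I[of 0]]) auto
  define b where "b = from_nat_into \<B>"
  have b: "range b = \<B>" unfolding b_def by (rule range_from_nat_into[OF \<open>\<B> \<noteq> {}\<close> \<B>(1)])
  have b_open: "open (b m)" for m
    by (rule topological_basis_open[OF \<B>(2)]) (simp only: b[symmetric] rangeI)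
  \<comment> \<open>A code \<open>(n, L)\<close> stands for the ball of radius \<open>n\<close> and a finite list of conditions on matrix
      coefficients, each naming two dense vectors and a basic open set of complex numbers.\<close>
  define N where "N = (\<lambda>(n::nat, L :: (nat \<times> nat \<times> nat) list).
    {B. op_bounded (real n) B \<and> (\<forall>(i, j, m)\<in>set L. cinner (apply_op B (d i)) (d j) \<in> b m)})"
  have base: "\<exists>L. A \<in> N (n, L) \<and> N (n, L) \<subseteq> G"
    if "generate_topology_on {{A. cinner (apply_op A \<xi>) \<eta> \<in> G} | \<xi> \<eta> G. open G} G"
      "A \<in> G" "op_bounded (real n) A" for G n A
    using that(1,2)
  proof induction
    case Empty
    then show ?case by simp
  next
    case (Int G H)
    then obtain L L' where "A \<in> N (n, L)" "N (n, L) \<subseteq> G" "A \<in> N (n, L')" "N (n, L') \<subseteq> H" by blast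
    moreover have "N (n, L @ L') = N (n, L) \<inter> N (n, L')"
      by (simp only: N_def prod.case set_append ball_Un) blast
    ultimately have "A \<in> N (n, L @ L') \<and> N (n, L @ L') \<subseteq> G \<inter> H" by blast
    then show ?case by blast
  next
    case (UN K)
    then show ?case by blast
  next
    case (Basis s)
    then obtain \<xi> \<eta> G where s: "s = {A. cinner (apply_op A \<xi>) \<eta> \<in> G}" "open G" by blast
    then obtain e where e: "e > 0" "ball (cinner (apply_op A \<xi>) \<eta>) e \<subseteq> G"
      using Basis open_contains_ball by blast
    obtain r where r: "r > 0" "(real n * norm \<eta>) * r < e / 6"
      using small_multiple[of "real n * norm \<eta>" "e / 6"] e(1) by auto
    obtain i where i: "norm (\<xi> - d i) < r" using near[OF r(1)] by blast
    obtain q where q: "q > 0" "(real n * norm (d i)) * q < e / 6"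
      using small_multiple[of "real n * norm (d i)" "e / 6"] e(1) by auto
    obtain j where j: "norm (\<eta> - d j) < q" using near[OF q(1)] by blast
    have close: "dist (cinner (apply_op B \<xi>) \<eta>) (cinner (apply_op B (d i)) (d j)) < e / 3"
      if B: "op_bounded (real n) B" for B
    proof -
      have "cinner (apply_op B \<xi>) \<eta> - cinner (apply_op B (d i)) (d j)
          = cinner (apply_op B (\<xi> - d i)) \<eta> + cinner (apply_op B (d i)) (\<eta> - d j)"
        by (simp add: op_diff cinner_diff_left cinner_diff_right)
      then have "dist (cinner (apply_op B \<xi>) \<eta>) (cinner (apply_op B (d i)) (d j))
          \<le> cmod (cinner (apply_op B (\<xi> - d i)) \<eta>) + cmod (cinner (apply_op B (d i)) (\<eta> - d j))"
        unfolding dist_norm using norm_triangle_ineq by metis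
      also have "\<dots> \<le> real n * norm (\<xi> - d i) * norm \<eta> + real n * norm (d i) * norm (\<eta> - d j)"
        using B unfolding op_bounded_def by (intro add_mono) auto
      also have "\<dots> \<le> (real n * norm \<eta>) * r + (real n * norm (d i)) * q"
      proof (rule add_mono)
        have "(real n * norm \<eta>) * norm (\<xi> - d i) \<le> (real n * norm \<eta>) * r"
          using i by (intro mult_left_mono) auto
        then show "real n * norm (\<xi> - d i) * norm \<eta> \<le> (real n * norm \<eta>) * r" by (simp add: mult_ac)
        show "real n * norm (d i) * norm (\<eta> - d j) \<le> (real n * norm (d i)) * q"
          using j by (intro mult_left_mono) auto
      qed
      finally show ?thesis using r(2) q(2) by linarith
    qed
    obtain S where S: "S \<in> \<B>" "cinner (apply_op A (d i)) (d j) \<in> S"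
        "S \<subseteq> ball (cinner (apply_op A (d i)) (d j)) (e / 3)"
      by (rule topological_basisE[OF \<B>(2) open_ball, of "cinner (apply_op A (d i)) (d j)"
          "cinner (apply_op A (d i)) (d j)" "e / 3"]) (use e(1) in auto)
    from S(1) obtain m where m: "b m = S" unfolding b[symmetric] by (elim rangeE) simp
    have "A \<in> N (n, [(i, j, m)])" unfolding N_def using m S that(3) by simp
    moreover have "N (n, [(i, j, m)]) \<subseteq> s"
    proof
      fix B assume "B \<in> N (n, [(i, j, m)])"
      then have B: "op_bounded (real n) B"
          "dist (cinner (apply_op A (d i)) (d j)) (cinner (apply_op B (d i)) (d j)) < e / 3"
        unfolding N_def using S(3) m by auto
      have "dist (cinner (apply_op A \<xi>) \<eta>) (cinner (apply_op B \<xi>) \<eta>) < e"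
        using close[OF that(3)] close[OF B(1)] B(2)
          dist_triangle[of "cinner (apply_op A \<xi>) \<eta>" "cinner (apply_op B \<xi>) \<eta>" "cinner (apply_op A (d i)) (d j)"]
          dist_triangle[of "cinner (apply_op A (d i)) (d j)" "cinner (apply_op B \<xi>) \<eta>" "cinner (apply_op B (d i)) (d j)"]
          dist_commute[of "cinner (apply_op B \<xi>) \<eta>" "cinner (apply_op B (d i)) (d j)"]
        by linarith
      then show "B \<in> s" using e(2) s(1) by auto
    qed
    ultimately show ?case by blast
  qed
  have coef: "{p \<in> space M. cinner (apply_op (f p) x) y \<in> G} \<in> sets M" if "G \<in> sets borel" for x y G
    using measurable_sets[OF f, of G x y] that by (simp add: vimage_def Int_def conj_commute)
  have bdd: "op_bounded r A \<longleftrightarrow> (\<forall>i j. cinner (apply_op A (d i)) (d j) \<in> cball 0 (r * norm (d i) * norm (d j)))"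
    for r A
    using op_bounded_dense[OF D(2), of A r] by (auto simp: op_bounded_def d[symmetric])
  have N_meas: "f -` N c \<inter> space M \<in> sets M" for c
  proof -
    obtain n L where c: "c = (n, L)" by (cases c)
    have 1: "{p \<in> space M. \<forall>i j. cinner (apply_op (f p) (d i)) (d j) \<in> cball 0 (real n * norm (d i) * norm (d j))} \<in> sets M"
      by (intro sets.sets_Collect_countable_All coef) simp
    have 2: "{p \<in> space M. \<forall>(i, j, m)\<in>set L. cinner (apply_op (f p) (d i)) (d j) \<in> b m} \<in> sets M"
    proof (induction L)
      case (Cons a L)
      obtain i j m where a: "a = (i, j, m)" by (cases a)
      have "{p \<in> space M. \<forall>(i, j, m)\<in>set (a # L). cinner (apply_op (f p) (d i)) (d j) \<in> b m}
        = {p \<in> space M. cinner (apply_op (f p) (d i)) (d j) \<in> b m} \<inter>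
          {p \<in> space M. \<forall>(i, j, m)\<in>set L. cinner (apply_op (f p) (d i)) (d j) \<in> b m}"
        by (auto simp: a)
      then show ?case using Cons coef[OF borel_open[OF b_open]] by simp
    qed simp
    have "f -` N c \<inter> space M =
      {p \<in> space M. \<forall>i j. cinner (apply_op (f p) (d i)) (d j) \<in> cball 0 (real n * norm (d i) * norm (d j))} \<inter>
      {p \<in> space M. \<forall>(i, j, m)\<in>set L. cinner (apply_op (f p) (d i)) (d j) \<in> b m}"
      unfolding c N_def bdd by auto
    then show ?thesis using sets.Int[OF 1 2] by simp
  qed
  show ?thesis
    unfolding op_borel_def
  proof (rule measurable_measure_of)
    fix G :: "'a bop set" assume "G \<in> {G. openin weak_operator_topology G}"
    then have G: "generate_topology_on {{A. cinner (apply_op A \<xi>) \<eta> \<in> G} | \<xi> \<eta> G. open G} G"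
      by (simp add: weak_operator_topology_def openin_topology_generated_by_iff)
    define C where "C = {c. N c \<subseteq> G}"
    have "G = (\<Union>c\<in>C. N c)"
    proof
      show "G \<subseteq> (\<Union>c\<in>C. N c)"
      proof
        fix A assume "A \<in> G"
        then show "A \<in> (\<Union>c\<in>C. N c)"
          using base[OF G] ex_op_bounded[of A] unfolding C_def by blast
      qed
    qed (auto simp: C_def)
    then have "f -` G \<inter> space M = (\<Union>c\<in>C. f -` N c \<inter> space M)" by auto
    also have "\<dots> \<in> sets M"
      by (rule sets.countable_UN'') (use N_meas in auto)
    finally show "f -` G \<inter> space M \<in> sets M" .
  qed auto
qed


section \<open>Normality and limits of contractions\<close>

lemma norm_mult_le_squares: "norm x * norm y \<le> (norm x)\<^sup>2 + (norm y)\<^sup>2"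
proof -
  have "0 \<le> (norm x - norm y)\<^sup>2" and "0 \<le> norm x * norm y" by simp_all
  then show ?thesis unfolding power2_diff by linarith
qed

text \<open>
  On contractions strong convergence implies \<open>\<sigma>\<close>-weak convergence: the terms of the series defining a
  subbasic functional are dominated by \<open>\<parallel>\<xi>\<^sub>n\<parallel> \<parallel>\<eta>\<^sub>n\<parallel>\<close>, so limit and sum may be exchanged.
\<close>

lemma eventually_sigma_weak:
  fixes P :: "nat \<Rightarrow> 'a::complex_hilbert_space bop"
  assumes P: "\<And>x. (\<lambda>N. apply_op (P N) x) \<longlonglongrightarrow> apply_op A x"
    and le: "\<And>N x. norm (apply_op (P N) x) \<le> norm x"
    and G: "openin sigma_weak_topology G" "A \<in> G"
  shows "\<forall>\<^sub>F N in sequentially. P N \<in> G"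
proof -
  have "generate_topology_on {{A. (\<Sum>n. cinner (apply_op A (\<xi> n)) (\<eta> n)) \<in> G} | (\<xi> :: nat \<Rightarrow> 'a) \<eta> G.
        summable (\<lambda>n. (norm (\<xi> n))\<^sup>2) \<and> summable (\<lambda>n. (norm (\<eta> n))\<^sup>2) \<and> open G} G"
    using G(1) unfolding sigma_weak_topology_def openin_topology_generated_by_iff .
  then show ?thesis using G(2)
  proof induction
    case (Int G H)
    then show ?case by (simp add: eventually_conj)
  next
    case (UN K)
    then obtain k where k: "k \<in> K" "A \<in> k" by blast
    then have "\<forall>\<^sub>F N in sequentially. P N \<in> k" using UN by blast
    then show ?case by eventually_elim (use k in blast)
  next
    case (Basis s)
    then obtain \<xi> \<eta> :: "nat \<Rightarrow> 'a" and G where s: "s = {A. (\<Sum>n. cinner (apply_op A (\<xi> n)) (\<eta> n)) \<in> G}"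
      "summable (\<lambda>n. (norm (\<xi> n))\<^sup>2)" "summable (\<lambda>n. (norm (\<eta> n))\<^sup>2)" "open G" by blast
    have "(\<lambda>N. \<Sum>n. cinner (apply_op (P N) (\<xi> n)) (\<eta> n)) \<longlonglongrightarrow> (\<Sum>n. cinner (apply_op A (\<xi> n)) (\<eta> n))"
    proof (rule tannerys_theorem[THEN conjunct2, THEN conjunct2])
      show "summable (\<lambda>n. (norm (\<xi> n))\<^sup>2 + (norm (\<eta> n))\<^sup>2)" using s by (intro summable_add)
      show "(\<lambda>N. cinner (apply_op (P N) (\<xi> n)) (\<eta> n)) \<longlonglongrightarrow> cinner (apply_op A (\<xi> n)) (\<eta> n)" for n
        by (intro tendsto_cinner P tendsto_const)
      have "cmod (cinner (apply_op (P N) (\<xi> n)) (\<eta> n)) \<le> (norm (\<xi> n))\<^sup>2 + (norm (\<eta> n))\<^sup>2" for n N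
      proof -
        have "cmod (cinner (apply_op (P N) (\<xi> n)) (\<eta> n)) \<le> norm (apply_op (P N) (\<xi> n)) * norm (\<eta> n)"
          by (rule cmod_cinner_le)
        also have "\<dots> \<le> norm (\<xi> n) * norm (\<eta> n)" by (intro mult_right_mono le) simp
        also have "\<dots> \<le> (norm (\<xi> n))\<^sup>2 + (norm (\<eta> n))\<^sup>2" by (rule norm_mult_le_squares)
        finally show ?thesis .
      qed
      then show "\<forall>\<^sub>F (n, N) in at_top \<times>\<^sub>F sequentially.
          cmod (cinner (apply_op (P N) (\<xi> n)) (\<eta> n)) \<le> (norm (\<xi> n))\<^sup>2 + (norm (\<eta> n))\<^sup>2"
        by (intro always_eventually) auto
    qed simp
    moreover have "(\<Sum>n. cinner (apply_op A (\<xi> n)) (\<eta> n)) \<in> G" using Basis s by simp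
    ultimately have "\<forall>\<^sub>F N in sequentially. (\<Sum>n. cinner (apply_op (P N) (\<xi> n)) (\<eta> n)) \<in> G"
      using s(4) topological_tendstoD by blast
    then show ?case by (simp add: s)
  qed simp
qed

text \<open>
  Vector functionals are \<open>\<sigma>\<close>-weakly continuous, being given by square summable sequences with one nonzero
  entry.  This is the form in which normality enters everything below.
\<close>

lemma normal_map_tendsto:
  fixes P :: "nat \<Rightarrow> 'a::complex_hilbert_space bop" and \<phi> :: "'a bop \<Rightarrow> 'b::complex_hilbert_space bop"
  assumes "normal_map \<phi>"
    and P: "\<And>x. (\<lambda>N. apply_op (P N) x) \<longlonglongrightarrow> apply_op A x"
    and le: "\<And>N x. norm (apply_op (P N) x) \<le> norm x"
  shows "(\<lambda>N. cinner (apply_op (\<phi> (P N)) y) z) \<longlonglongrightarrow> cinner (apply_op (\<phi> A) y) z"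
proof (rule topological_tendstoI)
  fix G :: "complex set" assume G: "open G" "cinner (apply_op (\<phi> A) y) z \<in> G"
  define \<xi> where "\<xi> n = (if n = 0 then y else 0)" for n :: nat
  define \<eta> where "\<eta> n = (if n = 0 then z else 0)" for n :: nat
  have sum: "(\<Sum>n. cinner (apply_op B (\<xi> n)) (\<eta> n)) = cinner (apply_op B y) z" for B :: "'b bop"
    using suminf_finite[of "{0}" "\<lambda>n. cinner (apply_op B (\<xi> n)) (\<eta> n)"] by (simp add: \<xi>_def \<eta>_def)
  have "summable (\<lambda>n. (norm (\<xi> n))\<^sup>2)" "summable (\<lambda>n. (norm (\<eta> n))\<^sup>2)"
    by (rule summable_finite[of "{0}"]; simp add: \<xi>_def \<eta>_def)+
  then have "openin sigma_weak_topology {B. (\<Sum>n. cinner (apply_op B (\<xi> n)) (\<eta> n)) \<in> G}"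
    unfolding sigma_weak_topology_def openin_topology_generated_by_iff
    using G(1) by (intro generate_topology_on.Basis) blast
  then have "openin sigma_weak_topology {B. cinner (apply_op B y) z \<in> G}" by (simp add: sum)
  then have "openin sigma_weak_topology {B \<in> topspace sigma_weak_topology. \<phi> B \<in> {B. cinner (apply_op B y) z \<in> G}}"
    using assms(1) unfolding normal_map_def continuous_map_def by blast
  moreover have "topspace sigma_weak_topology = (UNIV :: 'a bop set)"
  proof -
    have "openin sigma_weak_topology (UNIV :: 'a bop set)"
      unfolding sigma_weak_topology_def openin_topology_generated_by_iff
      by (intro generate_topology_on.Basis CollectI exI[of _ "\<lambda>_. 0"] exI[of _ UNIV]) auto
    then show ?thesis using openin_subset by blast
  qed
  ultimately have "openin sigma_weak_topology {B. cinner (apply_op (\<phi> B) y) z \<in> G}" by simp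
  from eventually_sigma_weak[OF P le this] G(2)
  show "\<forall>\<^sub>F N in sequentially. cinner (apply_op (\<phi> (P N)) y) z \<in> G" by simp
qed


section \<open>Small translates of sets of positive measure\<close>

lemma measure_less_of_emeasure:
  "X \<in> fmeasurable M \<Longrightarrow> 0 \<le> c \<Longrightarrow> emeasure M X < ennreal c \<Longrightarrow> measure M X < c"
  by (simp add: emeasure_eq_measure2 ennreal_less_iff)

text \<open>
  A compact part of \<open>E\<close> has an open neighbourhood of less than twice its measure; a translate that
  stays in the neighbourhood cannot be disjoint from the compact part.
\<close>

lemma small_translates_meet:
  fixes E :: "real set"
  assumes E: "E \<in> sets borel" "E \<subseteq> {0<..<1}" "emeasure lborel E \<noteq> 0"
  obtains \<delta> where "\<delta> > 0" "\<And>h. 0 < h \<Longrightarrow> h < \<delta> \<Longrightarrow> \<exists>t\<in>E. t + h \<in> E"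
proof -
  have E_leb: "E \<in> sets lebesgue" using E(1) by simp
  have bE: "bounded E" by (rule bounded_subset[OF bounded_box[of 0 1]]) (use E(2) in auto)
  have E_lm: "E \<in> lmeasurable" by (rule bounded_set_imp_lmeasurable[OF bE E_leb])
  define m where "m = measure lebesgue E"
  have "emeasure lebesgue E \<noteq> 0" using E(1,3) by simp
  then have "m > 0" using E_lm
    by (simp add: m_def emeasure_eq_measure2 zero_less_measure_iff)
  obtain T where T: "closed T" "T \<subseteq> E" "E - T \<in> lmeasurable" "emeasure lebesgue (E - T) < ennreal (m / 4)"
    using sets_lebesgue_inner_closed[OF E_leb, of "m / 4"] \<open>m > 0\<close> by auto
  obtain S where S: "open S" "E \<subseteq> S" "S - E \<in> lmeasurable" "emeasure lebesgue (S - E) < ennreal (m / 4)"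
    using sets_lebesgue_outer_open[OF E_leb, of "m / 4"] \<open>m > 0\<close> by auto
  have cT: "compact T" using T(1,2) bE by (meson bounded_subset compact_eq_bounded_closed)
  then have T_lm: "T \<in> lmeasurable" by (rule lmeasurable_compact)
  have S_lm: "S \<in> lmeasurable"
    using fmeasurable.Un[OF E_lm S(3)] S(2) by (simp add: Un_absorb1)
  have "measure lebesgue (E - T) = m - measure lebesgue T"
    unfolding m_def by (rule measurable_measure_Diff[OF E_lm _ T(2)]) (use T_lm in auto)
  then have mT: "measure lebesgue T > 3 * m / 4"
    using measure_less_of_emeasure[OF T(3) _ T(4)] \<open>m > 0\<close> by simp
  have "measure lebesgue (S - E) = measure lebesgue S - m"
    unfolding m_def by (rule measurable_measure_Diff[OF S_lm _ S(2)]) (use E_lm in auto)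
  then have mS: "measure lebesgue S < 5 * m / 4"
    using measure_less_of_emeasure[OF S(3) _ S(4)] \<open>m > 0\<close> by simp
  obtain \<delta> where \<delta>: "\<delta> > 0" "\<And>x y. x \<in> T \<Longrightarrow> y \<in> - S \<Longrightarrow> \<delta> \<le> dist x y"
    using separate_compact_closed[of T "- S"] cT S(1,2) T(2) by (metis Compl_disjoint closed_Compl
      disjoint_eq_subset_Compl double_complement order_trans)
  show ?thesis
  proof (rule that[OF \<delta>(1)])
    fix h :: real assume h: "0 < h" "h < \<delta>"
    show "\<exists>t\<in>E. t + h \<in> E"
    proof (rule ccontr)
      assume no: "\<not> ?thesis"
      let ?T = "(+) h ` T"
      have "?T \<subseteq> S"
      proof (rule image_subsetI, rule ccontr)
        fix t assume "t \<in> T" "h + t \<notin> S"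
        then show False using \<delta>(2)[of t "h + t"] h by (simp add: dist_real_def)
      qed
      then have sub: "T \<union> ?T \<subseteq> S" using T(2) S(2) by blast
      have disj: "T \<inter> ?T = {}" using no T(2) by (auto simp: add.commute)
      have T'_lm: "?T \<in> lmeasurable" using T_lm by (rule measurable_translation)
      have "measure lebesgue T + measure lebesgue ?T = measure lebesgue (T \<union> ?T)"
        by (simp add: measure_Un3[OF T_lm T'_lm] disj)
      also have "\<dots> \<le> measure lebesgue S"
        by (rule measure_mono_fmeasurable[OF sub _ S_lm])
          (intro fmeasurableD fmeasurable.Un T_lm T'_lm)
      finally have "measure lebesgue T + measure lebesgue ?T \<le> measure lebesgue S" .
      then show False using mT mS \<open>m > 0\<close> by (simp add: measure_translation)
    qed
  qed
qed

section \<open>Normal endomorphisms and their intertwiners\<close>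

lemma unitary_op_norm:
  assumes U: "unitary_op U"
  shows "norm (apply_op U x) = norm x"
proof -
  have "cinner (apply_op U x) (apply_op U x) = cinner x x"
    using U cinner_adj_right[of x U "apply_op U x"]
    by (metis apply_op_simps(1,2) unitary_op_def)
  then show ?thesis
    using Re_cinner_self[of "apply_op U x"] Re_cinner_self[of x] by simp
qed

lemma unitary_op_adj: "unitary_op U \<Longrightarrow> unitary_op (adj U)"
  by (simp add: unitary_op_def)

lemma unitary_op_star_hom:
  assumes "star_hom \<phi>" "\<phi> 1 = 1" "unitary_op U"
  shows "unitary_op (\<phi> U)"
  using assms unfolding unitary_op_def by (metis star_homD(3,4))

lemma unitary_op_one: "unitary_op 1"
  by (simp add: unitary_op_def)

text \<open>
  A map that preserves the inner products of a spanning family extends by summation along the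
  expansions of vectors; its adjoint maps back, so totality of the image family suffices for
  unitarity.  The value at a vector is pinned down by its inner products with the image family,
  which makes linearity automatic.
\<close>

lemma exists_unitary_extension:
  fixes f g :: "'i \<Rightarrow> 'a::complex_hilbert_space"
  assumes inner: "\<And>i j. i \<in> I \<Longrightarrow> j \<in> I \<Longrightarrow> cinner (g i) (g j) = cinner (f i) (f j)"
    and span: "\<And>z. \<exists>s :: nat \<Rightarrow> 'i. range s \<subseteq> I \<and> (\<lambda>n. f (s n)) sums z"
    and total: "\<And>y. (\<And>i. i \<in> I \<Longrightarrow> cinner y (g i) = 0) \<Longrightarrow> y = 0"
  obtains U where "unitary_op U" "\<And>i. i \<in> I \<Longrightarrow> apply_op U (f i) = g i"
proof -
  obtain s :: "'a \<Rightarrow> nat \<Rightarrow> 'i" where s: "\<And>z n. s z n \<in> I" "\<And>z. (\<lambda>n. f (s z n)) sums z"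
    using span by (metis range_subsetD)
  define X where "X z = (\<Sum>n. g (s z n))" for z
  have X: "(\<lambda>n. g (s z n)) sums X z" for z
  proof -
    have norm: "norm (\<Sum>k=m..<n. g (s z k)) = norm (\<Sum>k=m..<n. f (s z k))" for m n
    proof -
      have "cinner (\<Sum>k=m..<n. g (s z k)) (\<Sum>k=m..<n. g (s z k))
          = cinner (\<Sum>k=m..<n. f (s z k)) (\<Sum>k=m..<n. f (s z k))"
        by (simp add: cinner_sum_left cinner_sum_right inner s(1))
      then have "(norm (\<Sum>k=m..<n. g (s z k)))\<^sup>2 = (norm (\<Sum>k=m..<n. f (s z k)))\<^sup>2"
        by (simp only: cinner_self of_real_eq_iff)
      then show ?thesis by (simp add: power2_eq_iff_nonneg)
    qed
    have "summable (\<lambda>n. f (s z n))" using s(2) sums_summable by blast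
    then have "summable (\<lambda>n. g (s z n))" unfolding summable_Cauchy norm .
    then show ?thesis unfolding X_def by (rule summable_sums)
  qed
  have Xg: "cinner (X z) (g i) = cinner z (f i)" if "i \<in> I" for z i
  proof -
    have "(\<lambda>n. cinner (g (s z n)) (g i)) sums cinner (X z) (g i)"
      by (rule bounded_linear.sums[OF bounded_linear_cinner_left X])
    moreover have "(\<lambda>n. cinner (f (s z n)) (f i)) sums cinner z (f i)"
      by (rule bounded_linear.sums[OF bounded_linear_cinner_left s(2)])
    ultimately show ?thesis using that by (simp add: inner s(1) sums_unique2)
  qed
  have eqI: "x = y" if "\<And>i. i \<in> I \<Longrightarrow> cinner x (g i) = cinner y (g i)" for x y
    using total[of "x - y"] that by (simp add: cinner_diff_left)
  have Xf: "X (f i) = g i" if "i \<in> I" for i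
    using that by (intro eqI) (simp add: Xg inner)
  have iso: "cinner (X z) (X w) = cinner z w" for z w
  proof -
    have "(\<lambda>n. cinner (X z) (g (s w n))) sums cinner (X z) (X w)"
      by (rule bounded_linear.sums[OF bounded_linear_cinner_right X])
    moreover have "(\<lambda>n. cinner z (f (s w n))) sums cinner z w"
      by (rule bounded_linear.sums[OF bounded_linear_cinner_right s(2)])
    ultimately show ?thesis by (simp add: Xg s(1) sums_unique2)
  qed
  have normX: "norm (X z) = norm z" for z
    using Re_cinner_self[of "X z"] Re_cinner_self[of z] by (simp add: iso)
  define U where "U = Abs_bop X"
  have U: "apply_op U = X"
    unfolding U_def
  proof (rule bop_of_function[where K = 1])
    show "X (x + y) = X x + X y" for x y by (rule eqI) (simp add: Xg cinner_add_left)
    show "X (c *\<^sub>C x) = c *\<^sub>C X x" for c x by (rule eqI) (simp add: Xg cinner_scaleC_left)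
  qed (simp add: normX)
  have adjg: "apply_op (adj U) (g i) = f i" if "i \<in> I" for i
    by (rule cinner_eqI_right) (simp add: cinner_adj_right U Xg that)
  have "adj U * U = 1"
    by (intro bop_eqI cinner_eqI_right) (simp add: cinner_adj_right U iso)
  moreover have "U * adj U = 1"
  proof (rule bop_eqI, rule eqI)
    fix y i assume "i \<in> I"
    then show "cinner (apply_op (U * adj U) y) (g i) = cinner (apply_op 1 y) (g i)"
      by (simp add: cinner_adj_right[symmetric] adjg) (simp add: cinner_adj_left U Xf)
  qed
  ultimately show ?thesis by (intro that[of U]) (simp_all add: unitary_op_def U Xf)
qed

definition normal_endomorphism :: "('a::complex_hilbert_space bop \<Rightarrow> 'a bop) \<Rightarrow> bool" where
  "normal_endomorphism \<phi> \<longleftrightarrow> star_hom \<phi> \<and> \<phi> 1 = 1 \<and> normal_map \<phi>"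

definition intertwiners :: "('a::complex_hilbert_space bop \<Rightarrow> 'a bop) \<Rightarrow> 'a bop set" where
  "intertwiners \<phi> = {T. \<forall>A. \<phi> A * T = T * A}"

lemma fiber_eq_intertwiners: "fiber \<alpha> t = intertwiners (\<alpha> t)"
  by (simp add: fiber_def intertwiners_def)

text \<open>
  The map \<open>x \<mapsto> \<phi>(|x\<rangle>\<langle>u|) v\<close> intertwines \<open>\<phi>\<close> and the identity, as \<open>A |x\<rangle>\<langle>u| = |A x\<rangle>\<langle>u|\<close>.  For an
  \<open>E\<^sub>0\<close>-semigroup \<open>\<alpha>\<close> and fixed \<open>u, v\<close> the intertwiners \<open>rank1_intertwiner (\<alpha> t) u v\<close> form a weakly continuous
  section of the product system; such sections do the work of a measurable basis of the fibers.
\<close>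

definition rank1_intertwiner :: "('a::complex_hilbert_space bop \<Rightarrow> 'a bop) \<Rightarrow> 'a \<Rightarrow> 'a \<Rightarrow> 'a bop" where
  "rank1_intertwiner \<phi> u v = Abs_bop (\<lambda>x. apply_op (\<phi> (rank1 x u)) v)"

text \<open>
  Because \<open>|x\<rangle>\<langle>u|\<^sup>* |x\<rangle>\<langle>u| = \<parallel>x\<parallel>\<^sup>2 |u\<rangle>\<langle>u|\<close>, the vector \<open>\<phi>(|x\<rangle>\<langle>u|) v\<close> depends boundedly on \<open>x\<close>.
\<close>

lemma norm_star_hom_rank1:
  assumes "star_hom \<phi>"
  shows "(norm (apply_op (\<phi> (rank1 x u)) v))\<^sup>2 = (norm x)\<^sup>2 * Re (cinner (apply_op (\<phi> (rank1 u u)) v) v)"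
proof -
  have "cinner (apply_op (\<phi> (rank1 x u)) v) (apply_op (\<phi> (rank1 x u)) v)
      = cinner (apply_op (adj (\<phi> (rank1 x u)) * \<phi> (rank1 x u)) v) v"
    by (simp add: cinner_adj_left)
  also have "adj (\<phi> (rank1 x u)) * \<phi> (rank1 x u) = cinner x x *\<^sub>C \<phi> (rank1 u u)"
    by (simp add: star_homD[OF assms, symmetric] adj_rank1 rank1_times_rank1)
  finally have "complex_of_real ((norm (apply_op (\<phi> (rank1 x u)) v))\<^sup>2)
      = complex_of_real ((norm x)\<^sup>2) * cinner (apply_op (\<phi> (rank1 u u)) v) v"
    by (simp only: cinner_self scaleC_bop.rep_eq cinner_scaleC_left)
  from arg_cong[OF this, of Re] show ?thesis by (simp del: of_real_power)
qed

lemma apply_rank1_intertwiner: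
  assumes "star_hom \<phi>"
  shows "apply_op (rank1_intertwiner \<phi> u v) x = apply_op (\<phi> (rank1 x u)) v"
proof -
  have "apply_op (rank1_intertwiner \<phi> u v) = (\<lambda>x. apply_op (\<phi> (rank1 x u)) v)"
    unfolding rank1_intertwiner_def
  proof (rule bop_of_function)
    fix x
    let ?K = "Re (cinner (apply_op (\<phi> (rank1 u u)) v) v)"
    have "(norm (apply_op (\<phi> (rank1 x u)) v))\<^sup>2 = (norm x)\<^sup>2 * ?K" by (rule norm_star_hom_rank1[OF assms])
    then have "norm (apply_op (\<phi> (rank1 x u)) v) = sqrt ((norm x)\<^sup>2 * ?K)"
      by (metis norm_ge_zero real_sqrt_unique)
    then show "norm (apply_op (\<phi> (rank1 x u)) v) \<le> norm x * sqrt ?K"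
      by (simp add: real_sqrt_mult)
  qed (simp_all add: rank1_add rank1_scaleC star_homD[OF assms])
  then show ?thesis by simp
qed

lemma rank1_intertwiner_mem:
  assumes "star_hom \<phi>"
  shows "rank1_intertwiner \<phi> u v \<in> intertwiners \<phi>"
  unfolding intertwiners_def
  by (auto intro!: bop_eqI simp: apply_rank1_intertwiner[OF assms])
    (metis apply_op_simps(1) star_homD(3)[OF assms] times_rank1)

lemma norm_rank1_intertwiner_le:
  assumes "star_hom \<phi>" "norm u = 1"
  shows "norm (apply_op (rank1_intertwiner \<phi> u u) x) \<le> norm x"
proof -
  let ?p = "apply_op (\<phi> (rank1 u u)) u"
  have "(norm ?p)\<^sup>2 = Re (cinner ?p u)"
    using norm_star_hom_rank1[OF assms(1), of u u u] assms(2) by simp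
  moreover have "Re (cinner ?p u) \<le> norm ?p"
    using complex_Re_le_cmod cmod_cinner_le[of ?p u] assms(2) by (metis mult.right_neutral order_trans)
  ultimately have "Re (cinner ?p u) \<le> 1"
    using sq_le_mult_imp_le[of "norm ?p" 1] by simp
  then have "(norm (apply_op (rank1_intertwiner \<phi> u u) x))\<^sup>2 \<le> (norm x)\<^sup>2 * 1"
    unfolding apply_rank1_intertwiner[OF assms(1)] norm_star_hom_rank1[OF assms(1)]
    by (intro mult_left_mono) simp_all
  then show ?thesis by (simp add: power2_le_iff_abs_le)
qed

text \<open>
  A unital endomorphism maps the increasing projections onto spans of basis vectors to projections;
  normality makes these converge weakly to \<open>1\<close>, hence strongly.
\<close>

lemma normal_endomorphism_expansion:
  assumes \<phi>: "normal_endomorphism \<phi>" and e: "orthonormal_basis e"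
  shows "(\<lambda>n. apply_op (\<phi> (rank1 (e n) (e n))) z) sums z"
proof -
  have hom: "star_hom \<phi>" and one: "\<phi> 1 = 1" and nor: "normal_map \<phi>"
    using \<phi> by (auto simp: normal_endomorphism_def)
  have on: "\<forall>i j. cinner (e i) (e j) = of_bool (i = j)" using e by (simp add: orthonormal_basis_def)
  define P where "P N = (\<Sum>n<N. rank1 (e n) (e n))" for N :: nat
  have P: "apply_op (P N) x = (\<Sum>n<N. cinner x (e n) *\<^sub>C e n)" for N x
    by (simp add: P_def apply_op_sum)
  have "(norm (apply_op (P N) x))\<^sup>2 \<le> (norm x)\<^sup>2" for N x
    unfolding P norm_sum_orthonormal[OF on finite_lessThan] by (rule bessel[OF on finite_lessThan])
  then have le: "norm (apply_op (P N) x) \<le> norm x" for N x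
    by (simp add: power2_le_iff_abs_le)
  have adjP: "adj (P N) = P N" for N
    by (rule adj_eqI)
      (simp add: P cinner_sum_left cinner_sum_right cinner_scaleC_left cinner_scaleC_right
        cinner_commute[of "e n" for n] mult.commute)
  have PP: "P N * P N = P N" for N
  proof (rule bop_eqI)
    fix x
    have "cinner (apply_op (P N) x) (e n) = cinner x (e n)" if "n < N" for n
    proof -
      have "cinner (apply_op (P N) x) (e n) = (\<Sum>m<N. if m = n then cinner x (e m) else 0)"
        unfolding P cinner_sum_left by (rule sum.cong) (simp_all add: cinner_scaleC_left on)
      then show ?thesis using that by simp
    qed
    then show "apply_op (P N * P N) x = apply_op (P N) x"
      by (simp add: P[of N "apply_op (P N) x"]) (simp add: P)
  qed
  have lim: "(\<lambda>N. cinner (apply_op (\<phi> (P N)) z) z) \<longlonglongrightarrow> cinner (apply_op (\<phi> 1) z) z"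
    by (rule normal_map_tendsto[OF nor _ le])
      (use orthonormal_expansion[OF e] in \<open>simp add: P sums_def\<close>)
  have sq: "(norm (apply_op (\<phi> (P N)) z))\<^sup>2 = Re (cinner (apply_op (\<phi> (P N)) z) z)" for N
  proof -
    have "cinner (apply_op (\<phi> (P N)) z) (apply_op (\<phi> (P N)) z)
        = cinner (apply_op (adj (\<phi> (P N)) * \<phi> (P N)) z) z" by (simp add: cinner_adj_left)
    also have "adj (\<phi> (P N)) * \<phi> (P N) = \<phi> (P N)"
      by (simp add: star_homD[OF hom, symmetric] adjP PP)
    finally show ?thesis by (metis Re_cinner_self)
  qed
  have "norm (apply_op (\<phi> (P N)) z) \<le> norm z" for N
  proof (rule sq_le_mult_imp_le)
    show "(norm (apply_op (\<phi> (P N)) z))\<^sup>2 \<le> norm (apply_op (\<phi> (P N)) z) * norm z"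
      unfolding sq using complex_Re_le_cmod cmod_cinner_le order_trans by blast
  qed simp
  then have "(\<lambda>N. apply_op (\<phi> (P N)) z) \<longlonglongrightarrow> z"
    using lim by (intro weak_tendsto_imp_tendsto) (simp_all add: one)
  then show ?thesis
    by (simp add: sums_def P_def star_hom_sum[OF hom] apply_op_sum)
qed

text \<open>
  Since \<open>|e\<^sub>n\<rangle>\<langle>e\<^sub>n| = |e\<^sub>n\<rangle>\<langle>u| |u\<rangle>\<langle>e\<^sub>n|\<close> for a unit vector \<open>u\<close>, the expansion above displays every
  vector as a sum of vectors in ranges of intertwiners.
\<close>

lemma intertwiner_expansion:
  assumes \<phi>: "normal_endomorphism \<phi>" and e: "orthonormal_basis e" and u: "norm u = 1"
  shows "(\<lambda>n. apply_op (rank1_intertwiner \<phi> u (apply_op (\<phi> (rank1 u (e n))) z)) (e n)) sums z"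
proof -
  have hom: "star_hom \<phi>" using \<phi> by (auto simp: normal_endomorphism_def)
  have "cinner u u = 1" using u by (simp add: cinner_self)
  then have "\<phi> (rank1 (e n) (e n)) = \<phi> (rank1 (e n) u) * \<phi> (rank1 u (e n))" for n
    by (simp add: star_homD[OF hom, symmetric] rank1_times_rank1 scaleC_one)
  then show ?thesis
    using normal_endomorphism_expansion[OF \<phi> e, of z] by (simp add: apply_rank1_intertwiner[OF hom])
qed

text \<open>
  A vector orthogonal to the ranges of all intertwiners is orthogonal to every term of its own
  expansion.
\<close>

lemma intertwiners_total:
  fixes e :: "nat \<Rightarrow> 'a::complex_hilbert_space" and \<phi> :: "'a bop \<Rightarrow> 'a bop"
  assumes \<phi>: "normal_endomorphism \<phi>" and e: "orthonormal_basis e"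
    and y: "\<And>T x. T \<in> intertwiners \<phi> \<Longrightarrow> cinner y (apply_op T x) = 0"
  shows "y = 0"
proof -
  have hom: "star_hom \<phi>" using \<phi> by (auto simp: normal_endomorphism_def)
  have "(\<lambda>n. cinner y (apply_op (rank1_intertwiner \<phi> (e 0) (apply_op (\<phi> (rank1 (e 0) (e n))) y)) (e n))) sums cinner y y"
    by (intro bounded_linear.sums[OF bounded_linear_cinner_right] intertwiner_expansion assms orthonormal_basis_norm)
  then have "(\<lambda>_. 0) sums cinner y y" by (simp add: y rank1_intertwiner_mem[OF hom])
  then show ?thesis using sums_unique2[OF sums_zero] by (metis cinner_self_eq_0)
qed

lemma op_eqI_intertwiners:
  fixes e :: "nat \<Rightarrow> 'a::complex_hilbert_space" and \<phi> :: "'a bop \<Rightarrow> 'a bop"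
  assumes \<phi>: "normal_endomorphism \<phi>" and e: "orthonormal_basis e"
    and eq: "\<And>T x. T \<in> intertwiners \<phi> \<Longrightarrow> apply_op A (apply_op T x) = apply_op B (apply_op T x)"
  shows "A = B"
proof (rule bop_eqI, rule cinner_eqI)
  fix x z
  have "apply_op (adj A) z - apply_op (adj B) z = 0"
    by (rule intertwiners_total[OF \<phi> e]) (simp add: cinner_diff_left cinner_adj_left eq)
  then show "cinner (apply_op A x) z = cinner (apply_op B x) z"
    by (simp add: cinner_adj_right[symmetric])
qed

text \<open>
  Commutation with \<open>|x\<rangle>\<langle>u|\<close> forces \<open>C x = \<langle>C u, u\<rangle> x\<close>.
\<close>

lemma commutant_scalar:
  fixes C :: "'a::complex_hilbert_space bop"
  assumes "\<And>A. C * A = A * C" and u: "norm u = 1"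
  shows "C = cinner (apply_op C u) u *\<^sub>C 1"
proof (rule bop_eqI)
  fix x
  have "cinner u u = 1" using u by (simp add: cinner_self)
  then have "apply_op C x = apply_op (C * rank1 x u) u" by (simp add: scaleC_one)
  also have "\<dots> = apply_op (rank1 x u * C) u" by (simp add: assms(1))
  finally show "apply_op C x = apply_op (cinner (apply_op C u) u *\<^sub>C 1) x" by simp
qed

lemma fiber_inner_eq:
  fixes u :: "'a::complex_hilbert_space" and S T :: "'a bop"
  assumes "norm u = 1" and "adj T * S = c *\<^sub>C 1"
  shows "fiber_inner S T = c"
  unfolding fiber_inner_def
proof (rule the_equality)
  fix d assume "adj T * S = d *\<^sub>C 1"
  then have "c *\<^sub>C u = d *\<^sub>C u" using assms(2) by (metis apply_op_simps(2,7))
  then have "c * cinner u u = d * cinner u u" by (metis cinner_scaleC_left)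
  then show "d = c" using assms(1) by (simp add: cinner_self)
qed (rule assms(2))

text \<open>
  The operator \<open>T\<^sup>* S\<close> commutes with every \<open>A\<close>, because \<open>T\<^sup>* S A = T\<^sup>* \<phi>(A) S = A T\<^sup>* S\<close>; so it is the scalar
  that defines the inner product of the fiber.
\<close>

lemma cinner_intertwiners:
  fixes u :: "'a::complex_hilbert_space" and S T :: "'a bop"
  assumes hom: "star_hom \<phi>" and u: "norm u = 1"
    and S: "S \<in> intertwiners \<phi>" and T: "T \<in> intertwiners \<phi>"
  shows "cinner (apply_op S x) (apply_op T y) = fiber_inner S T * cinner x y"
proof -
  have "(adj T * S) * A = A * (adj T * S)" for A
  proof -
    have "adj T * (S * A) = adj T * (\<phi> A * S)" using S by (simp add: intertwiners_def)
    also have "\<dots> = adj (\<phi> (adj A) * T) * S"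
      by (simp add: adj_times star_homD(4)[OF hom, symmetric] mult.assoc)
    also have "\<dots> = adj (T * adj A) * S" using T by (simp add: intertwiners_def)
    finally show ?thesis by (simp add: adj_times mult.assoc)
  qed
  from commutant_scalar[OF this u] obtain c where c: "adj T * S = c *\<^sub>C 1" by blast
  have "cinner (apply_op S x) (apply_op T y) = cinner (apply_op (adj T * S) x) y"
    by (simp add: cinner_adj_left)
  then show ?thesis by (simp add: c fiber_inner_eq[OF u c] cinner_scaleC_left)
qed

section \<open>Measurable cocycles are strongly continuous\<close>

lemma E0_semigroupD:
  assumes "E0_semigroup \<alpha>"
  shows "\<alpha> 0 = id" and "0 \<le> s \<Longrightarrow> 0 \<le> t \<Longrightarrow> \<alpha> (s + t) A = \<alpha> s (\<alpha> t A)"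
    and "0 \<le> t \<Longrightarrow> normal_endomorphism (\<alpha> t)" and "0 \<le> t \<Longrightarrow> star_hom (\<alpha> t)"
    and "0 \<le> t \<Longrightarrow> \<alpha> t 1 = 1" and "continuous_on {0..} (\<lambda>t. cinner (apply_op (\<alpha> t A) x) y)"
  using assms by (auto simp: E0_semigroup_def normal_endomorphism_def)

lemma E0_semigroup_weak_limit:
  assumes "E0_semigroup \<alpha>"
  shows "((\<lambda>h. cinner (apply_op (\<alpha> h A) x) y) \<longlongrightarrow> cinner (apply_op A x) y) (at_right 0)"
proof -
  have "((\<lambda>h. cinner (apply_op (\<alpha> h A) x) y) \<longlongrightarrow> cinner (apply_op (\<alpha> 0 A) x) y) (at 0 within {0..})"
    using E0_semigroupD(6)[OF assms, of A x y] by (simp add: continuous_on_def)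
  then have "((\<lambda>h. cinner (apply_op (\<alpha> h A) x) y) \<longlongrightarrow> cinner (apply_op (\<alpha> 0 A) x) y) (at_right 0)"
    by (rule tendsto_within_subset) auto
  then show ?thesis by (simp add: E0_semigroupD(1)[OF assms])
qed

text \<open>
  Weak continuity at all operators includes the operator \<open>A\<^sup>* A\<close>, that is, convergence of the norms
  \<open>\<parallel>\<alpha>\<^sub>h(A) x\<parallel>\<close>.
\<close>

lemma E0_semigroup_strong_limit:
  assumes \<alpha>: "E0_semigroup \<alpha>"
  shows "((\<lambda>h. apply_op (\<alpha> h A) x) \<longlongrightarrow> apply_op A x) (at_right 0)"
proof -
  let ?y = "apply_op A x"
  have "((\<lambda>h. Re (cinner (apply_op (\<alpha> h (adj A * A)) x) x) - 2 * Re (cinner (apply_op (\<alpha> h A) x) ?y)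
      + (norm ?y)\<^sup>2) \<longlongrightarrow> Re (cinner (apply_op (adj A * A) x) x) - 2 * Re (cinner ?y ?y) + (norm ?y)\<^sup>2) (at_right 0)"
    by (intro tendsto_intros E0_semigroup_weak_limit[OF \<alpha>])
  then have lim: "((\<lambda>h. Re (cinner (apply_op (\<alpha> h (adj A * A)) x) x) - 2 * Re (cinner (apply_op (\<alpha> h A) x) ?y)
      + (norm ?y)\<^sup>2) \<longlongrightarrow> 0) (at_right 0)"
    by (simp add: cinner_adj_left Re_cinner_self)
  have "\<forall>\<^sub>F h in at_right 0. Re (cinner (apply_op (\<alpha> h (adj A * A)) x) x)
      - 2 * Re (cinner (apply_op (\<alpha> h A) x) ?y) + (norm ?y)\<^sup>2 = (norm (apply_op (\<alpha> h A) x - ?y))\<^sup>2"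
    using eventually_at_right_less[of "0::real"]
  proof eventually_elim
    case (elim h)
    then have hom: "star_hom (\<alpha> h)" using E0_semigroupD(4)[OF \<alpha>] by simp
    have "cinner (apply_op (\<alpha> h (adj A * A)) x) x = cinner (apply_op (\<alpha> h A) x) (apply_op (\<alpha> h A) x)"
      by (simp add: star_homD[OF hom] cinner_adj_left)
    then show ?case by (simp add: norm_diff_sq Re_cinner_self)
  qed
  then have "((\<lambda>h. (norm (apply_op (\<alpha> h A) x - ?y))\<^sup>2) \<longlongrightarrow> 0) (at_right 0)"
    by (rule Lim_transform_eventually[OF lim])
  then have "((\<lambda>h. norm (apply_op (\<alpha> h A) x - ?y)) \<longlongrightarrow> 0) (at_right 0)"
    using tendsto_real_sqrt[of "\<lambda>h. (norm (apply_op (\<alpha> h A) x - ?y))\<^sup>2" 0] by simp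
  then show ?thesis by (simp add: tendsto_norm_zero_iff LIM_zero_iff)
qed

text \<open>
  The intertwiners \<open>T\<^sub>h = rank1_intertwiner (\<alpha> h) u u\<close> and their adjoints tend to \<open>1\<close> strongly as \<open>h\<close> tends to \<open>0\<close>, while
  \<open>\<alpha>\<^sub>h(V) T\<^sub>h = T\<^sub>h V\<close>.  This compares \<open>\<alpha>\<^sub>h(V)\<close> with \<open>V\<close> at a rate that does not depend on \<open>V\<close>.
\<close>

lemma E0_semigroup_uniform_limit:
  fixes x y u :: "'a::complex_hilbert_space"
  assumes \<alpha>: "E0_semigroup \<alpha>" and u: "norm u = 1"
  obtains \<omega> :: "real \<Rightarrow> real" where "(\<omega> \<longlongrightarrow> 0) (at_right 0)"
    and "\<And>h V. 0 < h \<Longrightarrow> unitary_op V \<Longrightarrow>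
      cmod (cinner (apply_op (\<alpha> h V) x) y - cinner (apply_op V x) y) \<le> \<omega> h"
proof -
  define T where "T h = rank1_intertwiner (\<alpha> h) u u" for h
  define \<omega> where "\<omega> h = norm (x - apply_op (T h) x) * norm y + norm x * norm (apply_op (adj (T h)) y - y)" for h
  have uu: "cinner u u = 1" using u by (simp add: cinner_self)
  have T: "apply_op (T h) z = apply_op (\<alpha> h (rank1 z u)) u" if "0 < h" for h z
    unfolding T_def using E0_semigroupD(4)[OF \<alpha>, of h] that by (simp add: apply_rank1_intertwiner)
  have pos: "\<forall>\<^sub>F h in at_right 0. (0::real) < h" by (rule eventually_at_right_less)
  have T_lim: "((\<lambda>h. apply_op (T h) z) \<longlongrightarrow> z) (at_right 0)" for z
  proof -
    have "((\<lambda>h. apply_op (\<alpha> h (rank1 z u)) u) \<longlongrightarrow> apply_op (rank1 z u) u) (at_right 0)"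
      by (rule E0_semigroup_strong_limit[OF \<alpha>])
    then have lim: "((\<lambda>h. apply_op (\<alpha> h (rank1 z u)) u) \<longlongrightarrow> z) (at_right 0)"
      by (simp add: uu scaleC_one)
    show ?thesis
      by (rule Lim_transform_eventually[OF lim]) (use pos in eventually_elim, simp add: T)
  qed
  have T_le: "norm (apply_op (T h) z) \<le> norm z" if "0 < h" for h z
    unfolding T_def using E0_semigroupD(4)[OF \<alpha>, of h] that u by (simp add: norm_rank1_intertwiner_le)
  have "((\<lambda>h. apply_op (adj (T h)) y) \<longlongrightarrow> y) (at_right 0)"
  proof (rule weak_tendsto_imp_tendsto)
    show "((\<lambda>h. cinner (apply_op (adj (T h)) y) y) \<longlongrightarrow> cinner y y) (at_right 0)"
      unfolding cinner_adj_left by (intro tendsto_cinner tendsto_const T_lim)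
    show "\<forall>\<^sub>F h in at_right 0. norm (apply_op (adj (T h)) y) \<le> norm y"
      using pos
    proof eventually_elim
      case (elim h)
      let ?z = "apply_op (adj (T h)) y"
      have "(norm ?z)\<^sup>2 = Re (cinner (apply_op (T h) ?z) y)"
        by (simp add: Re_cinner_self[symmetric] cinner_adj_right)
      also have "\<dots> \<le> norm (apply_op (T h) ?z) * norm y"
        using complex_Re_le_cmod cmod_cinner_le order_trans by blast
      also have "\<dots> \<le> norm ?z * norm y" by (intro mult_right_mono T_le elim) simp
      finally show ?case by (rule sq_le_mult_imp_le) simp
    qed
  qed
  then have "(\<omega> \<longlongrightarrow> norm (x - x) * norm y + norm x * norm (y - y)) (at_right 0)"
    unfolding \<omega>_def by (intro tendsto_intros T_lim)
  then have "(\<omega> \<longlongrightarrow> 0) (at_right 0)" by simp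
  moreover have "cmod (cinner (apply_op (\<alpha> h V) x) y - cinner (apply_op V x) y) \<le> \<omega> h"
    if h: "0 < h" and V: "unitary_op V" for h V
  proof -
    have hom: "star_hom (\<alpha> h)" "\<alpha> h 1 = 1" using E0_semigroupD(4,5)[OF \<alpha>, of h] h by auto
    have "\<alpha> h V * T h = T h * V"
      using rank1_intertwiner_mem[OF hom(1), of u u] by (simp add: intertwiners_def T_def)
    then have TV: "apply_op (\<alpha> h V) (apply_op (T h) x) = apply_op (T h) (apply_op V x)"
      by (metis apply_op_simps(1))
    have "cinner (apply_op (\<alpha> h V) x) y - cinner (apply_op V x) y
        = cinner (apply_op (\<alpha> h V) (x - apply_op (T h) x)) y
          + cinner (apply_op V x) (apply_op (adj (T h)) y - y)"
      by (simp add: op_diff cinner_diff_left cinner_diff_right TV cinner_adj_right)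
    also have "cmod \<dots> \<le> cmod (cinner (apply_op (\<alpha> h V) (x - apply_op (T h) x)) y)
          + cmod (cinner (apply_op V x) (apply_op (adj (T h)) y - y))"
      by (rule norm_triangle_ineq)
    also have "\<dots> \<le> norm (apply_op (\<alpha> h V) (x - apply_op (T h) x)) * norm y
          + norm (apply_op V x) * norm (apply_op (adj (T h)) y - y)"
      by (intro add_mono cmod_cinner_le)
    also have "\<dots> = \<omega> h"
      by (simp add: \<omega>_def unitary_op_norm[OF V] unitary_op_norm[OF unitary_op_star_hom[OF hom V]])
    finally show ?thesis .
  qed
  ultimately show ?thesis by (rule that)
qed

text \<open>
  A family of unitaries that has all properties of a cocycle except that weak measurability on
  positive times replaces strong continuity.
\<close>

locale measurable_cocycle =
  fixes \<alpha> :: "real \<Rightarrow> 'a::complex_hilbert_space bop \<Rightarrow> 'a bop" and U :: "real \<Rightarrow> 'a bop" and u :: 'a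
  assumes E0: "E0_semigroup \<alpha>"
    and separable: "separable_space (euclidean :: 'a topology)"
    and unit: "norm u = 1"
    and unitary: "0 \<le> t \<Longrightarrow> unitary_op (U t)"
    and cocycle: "0 \<le> s \<Longrightarrow> 0 \<le> t \<Longrightarrow> U (s + t) = U s * \<alpha> s (U t)"
    and measurable: "(\<lambda>t. cinner (apply_op (U t) x) y) \<in> borel_measurable (restrict_space borel {0<..})"
begin

text \<open>
  Some vector \<open>d\<close> has \<open>\<parallel>U\<^sub>t d - \<eta>\<parallel> < \<epsilon>\<close> for all \<open>t\<close> in a set of positive measure, hence for a pair
  \<open>t, t + h\<close> whenever \<open>h\<close> is small.  As \<open>U\<^sub>h\<^sup>* U\<^bsub>t+h\<^esub> = \<alpha>\<^sub>h(U\<^sub>t)\<close> is uniformly close to \<open>U\<^sub>t\<close>,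
  \<open>U\<^sub>h\<^sup>* \<eta>\<close> is close to \<open>\<eta>\<close>.
\<close>

lemma tendsto_one:
  "((\<lambda>h. apply_op (adj (U h)) \<eta>) \<longlongrightarrow> \<eta>) (at_right 0)"
proof (rule weak_tendsto_imp_tendsto)
  show "\<forall>\<^sub>F h in at_right 0. norm (apply_op (adj (U h)) \<eta>) \<le> norm \<eta>"
    using eventually_at_right_less[of "0::real"]
    by eventually_elim (simp add: unitary_op_norm unitary_op_adj unitary)
  show "((\<lambda>h. cinner (apply_op (adj (U h)) \<eta>) \<eta>) \<longlongrightarrow> cinner \<eta> \<eta>) (at_right 0)"
  proof (rule tendstoI)
    fix r :: real assume r: "r > 0"
    obtain \<epsilon> where \<epsilon>: "\<epsilon> > 0" "2 * norm \<eta> * \<epsilon> < r / 2"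
      using small_multiple[of "2 * norm \<eta>" "r / 2"] r by auto
    obtain D :: "'a set" where D: "countable D" "closure D = UNIV"
      using separable by (auto simp: separable_space_def)
    have "D \<noteq> {}" using D(2) by (metis closure_empty empty_not_UNIV)
    define d where "d = from_nat_into D"
    have d: "range d = D" unfolding d_def by (rule range_from_nat_into[OF \<open>D \<noteq> {}\<close> D(1)])
    define E where "E k = {t \<in> {0<..<1}. norm (apply_op (U t) (d k) - \<eta>) < \<epsilon>}" for k
    have E_meas: "E k \<in> sets borel" for k
    proof -
      define c where "c = ((norm (d k))\<^sup>2 + (norm \<eta>)\<^sup>2 - \<epsilon>\<^sup>2) / 2"
      have iff: "norm (apply_op (U t) (d k) - \<eta>) < \<epsilon> \<longleftrightarrow> c < Re (cinner (apply_op (U t) (d k)) \<eta>)"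
        if "0 < t" for t
      proof -
        have "norm (apply_op (U t) (d k) - \<eta>) < \<epsilon> \<longleftrightarrow> (norm (apply_op (U t) (d k) - \<eta>))\<^sup>2 < \<epsilon>\<^sup>2"
          by (meson \<epsilon>(1) less_imp_le norm_ge_zero pos2 power_less_imp_less_base power_strict_mono)
        also have "\<dots> \<longleftrightarrow> c < Re (cinner (apply_op (U t) (d k)) \<eta>)"
          using that by (simp add: norm_diff_sq unitary_op_norm unitary c_def field_simps)
        finally show ?thesis .
      qed
      have "(\<lambda>t. Re (cinner (apply_op (U t) (d k)) \<eta>)) \<in> borel_measurable (restrict_space borel {0<..})"
        using measurable by measurable
      then have "{t \<in> space (restrict_space borel {0<..}). c < Re (cinner (apply_op (U t) (d k)) \<eta>)}
          \<in> sets (restrict_space borel {0<..})"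
        by measurable
      then have "{t \<in> {0<..}. c < Re (cinner (apply_op (U t) (d k)) \<eta>)} \<in> sets borel"
        by (simp add: sets_restrict_space_iff space_restrict_space)
      then have "{t \<in> {0<..}. c < Re (cinner (apply_op (U t) (d k)) \<eta>)} \<inter> {0<..<1} \<in> sets borel"
        by (intro sets.Int) simp_all
      also have "{t \<in> {0<..}. c < Re (cinner (apply_op (U t) (d k)) \<eta>)} \<inter> {0<..<1} = E k"
        by (auto simp: E_def iff)
      finally show ?thesis .
    qed
    have "(\<Union>k. E k) = {0<..<1}"
    proof
      show "{0<..<1} \<subseteq> (\<Union>k. E k)"
      proof
        fix t :: real assume t: "t \<in> {0<..<1}"
        have "apply_op (adj (U t)) \<eta> \<in> closure D" by (simp only: D(2) UNIV_I)
        then obtain y where y: "y \<in> D" "dist y (apply_op (adj (U t)) \<eta>) < \<epsilon>"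
          using closure_approachable[THEN iffD1, rule_format, OF _ \<epsilon>(1)] by blast
        from y(1) obtain k where k: "y = d k" unfolding d[symmetric] by (rule rangeE)
        have Ut: "unitary_op (U t)" using t unitary by simp
        then have "apply_op (U t) (apply_op (adj (U t)) \<eta>) = \<eta>"
          by (metis apply_op_simps(1,2) unitary_op_def)
        then have "norm (apply_op (U t) (d k) - \<eta>) = norm (apply_op (U t) (d k - apply_op (adj (U t)) \<eta>))"
          by (simp add: op_diff)
        also have "\<dots> < \<epsilon>" using y(2) k by (simp add: unitary_op_norm[OF Ut] dist_norm)
        finally show "t \<in> (\<Union>k. E k)" using t by (auto simp: E_def)
      qed
    qed (auto simp: E_def)
    have "\<exists>k. emeasure lborel (E k) \<noteq> 0"
    proof (rule ccontr)
      assume "\<not> ?thesis"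
      then have "emeasure lborel (\<Union>k. E k) = 0"
        by (intro emeasure_UN_eq_0) (use E_meas in auto)
      then show False unfolding \<open>(\<Union>k. E k) = {0<..<1}\<close> by simp
    qed
    then obtain k where k: "emeasure lborel (E k) \<noteq> 0" by blast
    have "E k \<subseteq> {0<..<1}" by (auto simp: E_def)
    from small_translates_meet[OF E_meas this k]
    obtain \<delta> where \<delta>: "\<delta> > 0" "\<And>h. 0 < h \<Longrightarrow> h < \<delta> \<Longrightarrow> \<exists>t\<in>E k. t + h \<in> E k" by blast
    obtain \<omega> where \<omega>: "(\<omega> \<longlongrightarrow> 0) (at_right 0)"
      "\<And>h V. 0 < h \<Longrightarrow> unitary_op V \<Longrightarrow>
        cmod (cinner (apply_op (\<alpha> h V) (d k)) \<eta> - cinner (apply_op V (d k)) \<eta>) \<le> \<omega> h"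
      using E0_semigroup_uniform_limit[OF E0 unit, of "d k" \<eta>] by blast
    have "\<forall>\<^sub>F h in at_right 0. \<omega> h < r / 2"
      using order_tendstoD(2)[OF \<omega>(1), of "r / 2"] r by simp
    moreover have "\<forall>\<^sub>F h in at_right 0. h \<in> {0<..<\<delta>}"
      using \<delta>(1) by (rule eventually_at_right_real)
    ultimately show "\<forall>\<^sub>F h in at_right 0. dist (cinner (apply_op (adj (U h)) \<eta>) \<eta>) (cinner \<eta> \<eta>) < r"
    proof eventually_elim
      case (elim h)
      then obtain t where t: "t \<in> E k" "t + h \<in> E k" using \<delta>(2)[of h] by auto
      have pos: "0 < t" "0 < h" using t elim by (auto simp: E_def)
      have Uh: "unitary_op (adj (U h))" and Ut: "unitary_op (U t)"
        using unitary[of h] unitary[of t] pos by (auto simp: unitary_op_adj)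
      have "U (t + h) = U h * \<alpha> h (U t)"
        using cocycle[of h t] pos by (simp add: add.commute)
      then have Uth: "apply_op (adj (U h)) (apply_op (U (t + h)) (d k)) = apply_op (\<alpha> h (U t)) (d k)"
        using Uh by (metis adj_adj apply_op_simps(1,2) unitary_op_def)
      have small: "norm (\<eta> - apply_op (U (t + h)) (d k)) < \<epsilon>" "norm (apply_op (U t) (d k) - \<eta>) < \<epsilon>"
        using t by (auto simp: E_def norm_minus_commute)
      have "cinner (apply_op (adj (U h)) \<eta>) \<eta> - cinner \<eta> \<eta>
          = cinner (apply_op (adj (U h)) (\<eta> - apply_op (U (t + h)) (d k))) \<eta>
            + (cinner (apply_op (\<alpha> h (U t)) (d k)) \<eta> - cinner (apply_op (U t) (d k)) \<eta>)
            + cinner (apply_op (U t) (d k) - \<eta>) \<eta>"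
        by (simp add: op_diff cinner_diff_left Uth)
      also have "cmod \<dots> \<le> norm (apply_op (adj (U h)) (\<eta> - apply_op (U (t + h)) (d k))) * norm \<eta>
            + \<omega> h + norm (apply_op (U t) (d k) - \<eta>) * norm \<eta>"
        by (intro norm_triangle_le add_mono cmod_cinner_le \<omega>(2) pos Ut)
      also have "\<dots> \<le> \<epsilon> * norm \<eta> + \<omega> h + \<epsilon> * norm \<eta>"
        using small by (intro add_mono mult_right_mono) (simp_all add: unitary_op_norm[OF Uh])
      also have "\<dots> < r" using \<epsilon>(2) elim by (simp add: mult_ac)
      finally show ?case by (simp add: dist_norm)
    qed
  qed
qed

lemma strongly_continuous: "continuous_on {0..} (\<lambda>t. apply_op (U t) \<xi>)"
proof -
  have weak: "continuous_on {0..} (\<lambda>t. cinner (apply_op (U t) \<xi>) \<eta>)" for \<eta>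
  proof -
    obtain \<omega> where \<omega>: "(\<omega> \<longlongrightarrow> 0) (at_right 0)"
      "\<And>h V. 0 < h \<Longrightarrow> unitary_op V \<Longrightarrow>
        cmod (cinner (apply_op (\<alpha> h V) \<xi>) \<eta> - cinner (apply_op V \<xi>) \<eta>) \<le> \<omega> h"
      using E0_semigroup_uniform_limit[OF E0 unit, of \<xi> \<eta>] by blast
    define \<kappa> where "\<kappa> h = norm \<xi> * norm (apply_op (adj (U h)) \<eta> - \<eta>) + \<omega> h" for h
    have "(\<kappa> \<longlongrightarrow> norm \<xi> * norm (\<eta> - \<eta>) + 0) (at_right 0)"
      unfolding \<kappa>_def by (intro tendsto_intros tendsto_one \<omega>(1))
    then have \<kappa>: "(\<kappa> \<longlongrightarrow> 0) (at_right 0)" by simp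
    \<comment> \<open>Splitting \<open>U\<^bsub>s+h\<^esub>\<close> as \<open>U\<^sub>h \<alpha>\<^sub>h(U\<^sub>s)\<close> gives a modulus of continuity independent of \<open>s\<close>, so left and
        right limits are covered at once.\<close>
    have step: "dist (cinner (apply_op (U (s + h)) \<xi>) \<eta>) (cinner (apply_op (U s) \<xi>) \<eta>) \<le> \<kappa> h"
      if s: "0 \<le> s" and h: "0 < h" for s h
    proof -
      have Us: "unitary_op (U s)" by (rule unitary[OF s])
      have "unitary_op (\<alpha> h (U s))"
        using unitary_op_star_hom[of "\<alpha> h" "U s"] E0_semigroupD(4,5)[OF E0, of h] h Us by simp
      note aUs = unitary_op_norm[OF this]
      have "U (s + h) = U h * \<alpha> h (U s)"
        using cocycle[of h s] s h by (simp add: add.commute)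
      then have "cinner (apply_op (U (s + h)) \<xi>) \<eta> - cinner (apply_op (U s) \<xi>) \<eta>
        = cinner (apply_op (\<alpha> h (U s)) \<xi>) (apply_op (adj (U h)) \<eta> - \<eta>)
          + (cinner (apply_op (\<alpha> h (U s)) \<xi>) \<eta> - cinner (apply_op (U s) \<xi>) \<eta>)"
        by (simp add: cinner_diff_right cinner_adj_right)
      also have "cmod \<dots> \<le> norm (apply_op (\<alpha> h (U s)) \<xi>) * norm (apply_op (adj (U h)) \<eta> - \<eta>) + \<omega> h"
        by (intro norm_triangle_le add_mono cmod_cinner_le \<omega>(2) h Us)
      finally show ?thesis by (simp add: dist_norm \<kappa>_def aUs)
    qed
    show ?thesis
      unfolding continuous_on_iff
    proof (intro ballI allI impI)
      fix s r :: real assume s: "s \<in> {0..}" and r: "0 < r"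
      have "\<forall>\<^sub>F h in at_right 0. \<kappa> h < r" by (rule order_tendstoD(2)[OF \<kappa> r])
      then obtain \<delta> where \<delta>: "\<delta> > 0" "\<And>h. 0 < h \<Longrightarrow> h < \<delta> \<Longrightarrow> \<kappa> h < r"
        unfolding eventually_at_right_field by blast
      have "dist (cinner (apply_op (U t) \<xi>) \<eta>) (cinner (apply_op (U s) \<xi>) \<eta>) < r"
        if t: "t \<in> {0..}" "dist t s < \<delta>" for t
      proof (cases t s rule: linorder_cases)
        case less
        then have "\<kappa> (s - t) < r" using \<delta>(2)[of "s - t"] t by (simp add: dist_real_def)
        then show ?thesis using step[of t "s - t"] t less by (simp add: dist_commute)
      next
        case greater
        then have "\<kappa> (t - s) < r" using \<delta>(2)[of "t - s"] t by (simp add: dist_real_def)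
        then show ?thesis using step[of s "t - s"] s greater by simp
      qed (use r in simp)
      then show "\<exists>\<delta>>0. \<forall>t\<in>{0..}. dist t s < \<delta> \<longrightarrow>
          dist (cinner (apply_op (U t) \<xi>) \<eta>) (cinner (apply_op (U s) \<xi>) \<eta>) < r"
        using \<delta>(1) by blast
    qed
  qed
  show ?thesis
    unfolding continuous_on_def
  proof (intro ballI weak_tendsto_imp_tendsto)
    fix s :: real assume s: "s \<in> {0..}"
    show "((\<lambda>t. cinner (apply_op (U t) \<xi>) (apply_op (U s) \<xi>)) \<longlongrightarrow>
        cinner (apply_op (U s) \<xi>) (apply_op (U s) \<xi>)) (at s within {0..})"
      using weak[of "apply_op (U s) \<xi>"] s by (simp add: continuous_on_def)
    show "\<forall>\<^sub>F t in at s within {0..}. norm (apply_op (U t) \<xi>) \<le> norm (apply_op (U s) \<xi>)"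
      using s unfolding eventually_at_filter
      by (intro always_eventually) (simp add: unitary_op_norm[OF unitary])
  qed
qed

end

section \<open>From isomorphic product systems to a cocycle\<close>

lemma product_system_iff: "(t, T) \<in> product_system \<alpha> \<longleftrightarrow> 0 < t \<and> T \<in> intertwiners (\<alpha> t)"
  by (simp add: product_system_def fiber_eq_intertwiners)

lemma space_ps_borel: "space (ps_borel \<alpha>) = product_system \<alpha>"
  by (simp add: ps_borel_def space_restrict_space space_pair_measure)

lemma measurable_snd_ps_borel: "snd \<in> ps_borel \<alpha> \<rightarrow>\<^sub>M op_borel"
  unfolding ps_borel_def by (rule measurable_restrict_space1) (rule measurable_snd)

lemma measurable_into_ps_borel:
  assumes "f \<in> M \<rightarrow>\<^sub>M borel" "g \<in> M \<rightarrow>\<^sub>M op_borel"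
    and "\<And>p. p \<in> space M \<Longrightarrow> (f p, g p) \<in> product_system \<alpha>"
  shows "(\<lambda>p. (f p, g p)) \<in> M \<rightarrow>\<^sub>M ps_borel \<alpha>"
  unfolding ps_borel_def
  by (rule measurable_restrict_space2) (use assms in \<open>auto intro: measurable_Pair\<close>)

lemma intertwiners_times:
  assumes \<alpha>: "E0_semigroup \<alpha>" and "0 \<le> s" "0 \<le> t"
    and "S \<in> intertwiners (\<alpha> s)" "T \<in> intertwiners (\<alpha> t)"
  shows "S * T \<in> intertwiners (\<alpha> (s + t))"
proof -
  have "\<alpha> (s + t) A * (S * T) = S * T * A" for A
  proof -
    have "\<alpha> (s + t) A * (S * T) = (\<alpha> s (\<alpha> t A) * S) * T"
      using E0_semigroupD(2)[OF \<alpha> assms(2,3)] by (simp add: mult.assoc)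
    also have "\<dots> = S * (\<alpha> t A * T)" using assms(4) by (simp add: intertwiners_def mult.assoc)
    also have "\<dots> = S * (T * A)" using assms(5) by (simp add: intertwiners_def)
    finally show ?thesis by (simp add: mult.assoc)
  qed
  then show ?thesis by (simp add: intertwiners_def)
qed

lemma continuous_on_max_zero:
  fixes f :: "real \<Rightarrow> 'b::topological_space"
  assumes "continuous_on {0..} f"
  shows "continuous_on UNIV (\<lambda>t. f (max t 0))"
  by (rule continuous_on_compose2[OF assms]) (auto intro!: continuous_intros)

lemma measurable_restrict_positive:
  fixes f :: "real \<Rightarrow> complex"
  assumes "continuous_on {0..} f"
  shows "f \<in> borel_measurable (restrict_space borel {0<..})"
  by (rule borel_measurable_continuous_on_restrict[OF continuous_on_subset[OF assms]]) auto

text \<open>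
  Fix any unitary \<open>W\<close> between the two spaces and let \<open>\<upsilon>\<^sub>t\<close> be the isomorphism of the fibers at time \<open>t\<close>.
  For intertwiners \<open>S, T\<close> of \<open>\<alpha>\<^sub>t\<close> the vectors \<open>T x\<close> and \<open>W\<^sup>* \<upsilon>\<^sub>t(T) W x\<close> have the same inner products, namely
  \<open>\<langle>S, T\<rangle> \<langle>x, y\<rangle>\<close>, and both families are total.  Hence there is a unitary \<open>U\<^sub>t\<close> with
  \<open>U\<^sub>t T x = W\<^sup>* \<upsilon>\<^sub>t(T) W x\<close>.  Testing on vectors \<open>S T x\<close> gives the cocycle identity, testing on \<open>T x\<close> gives
  \<open>U\<^sub>t \<alpha>\<^sub>t(W\<^sup>* B W) U\<^sub>t\<^sup>* = W\<^sup>* \<beta>\<^sub>t(B) W\<close>.  Measurability of the isomorphism makes \<open>U\<close> weakly measurable, and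
  measurable cocycles are continuous.
\<close>

lemma ps_isomorphic_imp_cocycle_conjugate:
  fixes \<alpha> :: "real \<Rightarrow> 'h::complex_hilbert_space bop \<Rightarrow> 'h bop"
    and \<beta> :: "real \<Rightarrow> 'k::complex_hilbert_space bop \<Rightarrow> 'k bop"
  assumes sepH: "separable_space (euclidean :: 'h topology)"
    and sepK: "separable_space (euclidean :: 'k topology)"
    and e: "orthonormal_basis (e :: nat \<Rightarrow> 'h)" and f: "orthonormal_basis (f :: nat \<Rightarrow> 'k)"
    and \<alpha>: "E0_semigroup \<alpha>" and \<beta>: "E0_semigroup \<beta>"
    and iso: "ps_isomorphism \<alpha> \<beta> \<theta>"
  shows "\<exists>U. cocycle \<alpha> U \<and> conjugate \<beta> (perturbation \<alpha> U)"
proof -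
  let ?M = "restrict_space borel {0<..} :: real measure"
  have u0: "norm (e 0) = 1" and f0: "norm (f 0) = 1"
    using orthonormal_basis_norm e f by blast+
  obtain W :: "'h \<Rightarrow> 'k" where W: "hilbert_iso W" using exists_hilbert_iso[OF e f] by blast
  note W' = hilbert_iso_inv(1)[OF W]
  have homA: "star_hom (\<alpha> t)" and homB: "star_hom (\<beta> t)" and norA: "normal_endomorphism (\<alpha> t)"
    and norB: "normal_endomorphism (\<beta> t)" if "0 < t" for t
    using E0_semigroupD(3,4)[OF \<alpha>, of t] E0_semigroupD(3,4)[OF \<beta>, of t] that by auto
  have "\<forall>t. \<exists>u. 0 < t \<longrightarrow> fiber_unitary (intertwiners (\<alpha> t)) (intertwiners (\<beta> t)) u \<and>
                (\<forall>T\<in>intertwiners (\<alpha> t). \<theta> (t, T) = (t, u T))"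
    using iso unfolding ps_isomorphism_def fiber_eq_intertwiners by blast
  then obtain \<upsilon> where \<upsilon>: "\<And>t. 0 < t \<Longrightarrow> fiber_unitary (intertwiners (\<alpha> t)) (intertwiners (\<beta> t)) (\<upsilon> t)"
    and \<theta>: "\<And>t T. 0 < t \<Longrightarrow> T \<in> intertwiners (\<alpha> t) \<Longrightarrow> \<theta> (t, T) = (t, \<upsilon> t T)" by metis
  have \<upsilon>_in: "\<upsilon> t T \<in> intertwiners (\<beta> t)" if "0 < t" "T \<in> intertwiners (\<alpha> t)" for t T
    using \<upsilon>[OF that(1)] that(2) unfolding fiber_unitary_def bij_betw_def by blast
  have \<upsilon>_times: "\<upsilon> (s + t) (S * T) = \<upsilon> s S * \<upsilon> t T"
    if "0 < s" "0 < t" "S \<in> intertwiners (\<alpha> s)" "T \<in> intertwiners (\<alpha> t)" for s t S T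
  proof -
    have "\<theta> (ps_mult (s, S) (t, T)) = ps_mult (\<theta> (s, S)) (\<theta> (t, T))"
      using iso that unfolding ps_isomorphism_def by (metis product_system_iff)
    moreover have "S * T \<in> intertwiners (\<alpha> (s + t))"
      by (rule intertwiners_times[OF \<alpha>]) (use that in auto)
    ultimately show ?thesis using that by (simp add: ps_mult_def \<theta>)
  qed

  have "\<exists>V. unitary_op V \<and>
      (\<forall>T\<in>intertwiners (\<alpha> t). \<forall>x. apply_op V (apply_op T x) = inv W (apply_op (\<upsilon> t T) (W x)))"
    if t: "0 < t" for t
  proof -
    let ?I = "intertwiners (\<alpha> t) \<times> UNIV"
    obtain V where V: "unitary_op V" "\<And>i. i \<in> ?I \<Longrightarrow>
        apply_op V (case i of (T, x) \<Rightarrow> apply_op T x) = (case i of (T, x) \<Rightarrow> inv W (apply_op (\<upsilon> t T) (W x)))"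
    proof (rule exists_unitary_extension[of ?I "\<lambda>(T, x). inv W (apply_op (\<upsilon> t T) (W x))" "\<lambda>(T, x). apply_op T x"])
      fix i j :: "'h bop \<times> 'h" assume i: "i \<in> ?I" and j: "j \<in> ?I"
      obtain S x T y where ij: "i = (S, x)" "j = (T, y)" by (cases i, cases j)
      have ST: "S \<in> intertwiners (\<alpha> t)" "T \<in> intertwiners (\<alpha> t)" using i j ij by auto
      have "cinner (inv W (apply_op (\<upsilon> t S) (W x))) (inv W (apply_op (\<upsilon> t T) (W y)))
          = cinner (apply_op (\<upsilon> t S) (W x)) (apply_op (\<upsilon> t T) (W y))"
        using W' by (simp add: hilbert_iso_def)
      also have "\<dots> = fiber_inner (\<upsilon> t S) (\<upsilon> t T) * cinner (W x) (W y)"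
        by (rule cinner_intertwiners[OF homB[OF t] f0 \<upsilon>_in[OF t ST(1)] \<upsilon>_in[OF t ST(2)]])
      also have "\<dots> = fiber_inner S T * cinner x y"
        using \<upsilon>[OF t] ST W unfolding fiber_unitary_def hilbert_iso_def by simp
      also have "\<dots> = cinner (apply_op S x) (apply_op T y)"
        by (rule cinner_intertwiners[OF homA[OF t] u0 ST, symmetric])
      finally show "cinner (case i of (T, x) \<Rightarrow> inv W (apply_op (\<upsilon> t T) (W x)))
          (case j of (T, x) \<Rightarrow> inv W (apply_op (\<upsilon> t T) (W x)))
          = cinner (case i of (T, x) \<Rightarrow> apply_op T x) (case j of (T, x) \<Rightarrow> apply_op T x)"
        by (simp add: ij)
    next
      fix z :: 'h
      let ?s = "\<lambda>n. (rank1_intertwiner (\<alpha> t) (e 0) (apply_op (\<alpha> t (rank1 (e 0) (e n))) z), e n)"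
      have "range ?s \<subseteq> ?I" using rank1_intertwiner_mem[OF homA[OF t]] by auto
      moreover have "(\<lambda>n. case ?s n of (T, x) \<Rightarrow> apply_op T x) sums z"
        using intertwiner_expansion[OF norA[OF t] e u0, of z] by simp
      ultimately show "\<exists>s. range s \<subseteq> ?I \<and> (\<lambda>n. case s n of (T, x) \<Rightarrow> apply_op T x) sums z" by blast
    next
      fix y :: 'h
      assume y: "\<And>i. i \<in> ?I \<Longrightarrow> cinner y (case i of (T, x) \<Rightarrow> inv W (apply_op (\<upsilon> t T) (W x))) = 0"
      have "W y = 0"
      proof (rule intertwiners_total[OF norB[OF t] f])
        fix S x assume "S \<in> intertwiners (\<beta> t)"
        then obtain T where T: "T \<in> intertwiners (\<alpha> t)" "S = \<upsilon> t T"
          using \<upsilon>[OF t] unfolding fiber_unitary_def bij_betw_def by blast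
        have "cinner (W y) (apply_op S x) = cinner y (inv W (apply_op (\<upsilon> t T) (W (inv W x))))"
          by (simp add: T hilbert_iso_inv[OF W])
        also have "\<dots> = 0" using y[of "(T, inv W x)"] T(1) by simp
        finally show "cinner (W y) (apply_op S x) = 0" .
      qed
      then show "y = 0" using hilbert_iso_norm[OF W, of y] by simp
    qed blast
    then show ?thesis by (intro exI[of _ V]) auto
  qed
  then obtain V where V: "\<And>t. 0 < t \<Longrightarrow> unitary_op (V t)"
    and VT: "\<And>t T x. 0 < t \<Longrightarrow> T \<in> intertwiners (\<alpha> t) \<Longrightarrow>
        apply_op (V t) (apply_op T x) = inv W (apply_op (\<upsilon> t T) (W x))" by metis
  \<comment> \<open>The product system has no fiber at time \<open>0\<close>.\<close>
  define U where "U t = (if t = 0 then 1 else V t)" for t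
  have UT: "apply_op (U t) (apply_op T x) = inv W (apply_op (\<upsilon> t T) (W x))"
    if "0 < t" "T \<in> intertwiners (\<alpha> t)" for t T x
    using VT[OF that] that(1) by (simp add: U_def)
  have unit: "unitary_op (U t)" if "0 \<le> t" for t
    using V[of t] that by (simp add: U_def unitary_op_one)

  have coc: "U (s + t) = U s * \<alpha> s (U t)" if st: "0 \<le> s" "0 \<le> t" for s t
  proof (cases "s = 0 \<or> t = 0")
    case True
    then show ?thesis
      using E0_semigroupD(1)[OF \<alpha>] E0_semigroupD(5)[OF \<alpha> st(1)] by (auto simp: U_def)
  next
    case False
    then have s: "0 < s" and t: "0 < t" using st by auto
    show ?thesis
    proof (rule op_eqI_intertwiners[OF norA[OF s] e])
      fix S x assume S: "S \<in> intertwiners (\<alpha> s)"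
      have "U (s + t) * S = (U s * \<alpha> s (U t)) * S"
      proof (rule op_eqI_intertwiners[OF norA[OF t] e])
        fix T x assume T: "T \<in> intertwiners (\<alpha> t)"
        have "S * T \<in> intertwiners (\<alpha> (s + t))"
          by (rule intertwiners_times[OF \<alpha> st S T])
        from UT[OF _ this] s t
        have "apply_op (U (s + t)) (apply_op S (apply_op T x))
            = inv W (apply_op (\<upsilon> s S) (apply_op (\<upsilon> t T) (W x)))"
          by (simp add: \<upsilon>_times[OF s t S T])
        moreover have "apply_op (\<alpha> s (U t)) (apply_op S (apply_op T x)) = apply_op S (apply_op (U t) (apply_op T x))"
          using S unfolding intertwiners_def by (metis (mono_tags, lifting) apply_op_simps(1) mem_Collect_eq)
        ultimately show "apply_op (U (s + t) * S) (apply_op T x) = apply_op (U s * \<alpha> s (U t) * S) (apply_op T x)"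
          by (simp add: UT[OF s S] UT[OF t T] hilbert_iso_inv(2)[OF W])
      qed
      then show "apply_op (U (s + t)) (apply_op S x) = apply_op (U s * \<alpha> s (U t)) (apply_op S x)"
        by (metis apply_op_simps(1))
    qed
  qed

  have meas: "(\<lambda>t. cinner (apply_op (U t) z) y) \<in> borel_measurable ?M" for z y
  proof -
    have section_meas: "(\<lambda>t. cinner (apply_op (U t) (apply_op (rank1_intertwiner (\<alpha> t) (e 0) v) x)) y) \<in> borel_measurable ?M"
      for v x
    proof -
      let ?T = "\<lambda>t. rank1_intertwiner (\<alpha> t) (e 0) v"
      have "?T \<in> ?M \<rightarrow>\<^sub>M op_borel"
      proof (rule measurable_op_borelI[OF sepH])
        fix x y
        have "(\<lambda>t. cinner (apply_op (\<alpha> t (rank1 x (e 0))) v) y) \<in> borel_measurable ?M"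
          by (rule measurable_restrict_positive[OF E0_semigroupD(6)[OF \<alpha>]])
        then show "(\<lambda>t. cinner (apply_op (?T t) x) y) \<in> borel_measurable ?M"
          by (rule measurable_cong[THEN iffD1, rotated])
            (simp add: space_restrict_space apply_rank1_intertwiner[OF homA])
      qed
      then have "(\<lambda>t. (t, ?T t)) \<in> ?M \<rightarrow>\<^sub>M ps_borel \<alpha>"
        by (intro measurable_into_ps_borel)
          (auto simp: space_restrict_space product_system_iff rank1_intertwiner_mem homA
            intro: measurable_restrict_space1)
      moreover have "\<theta> \<in> ps_borel \<alpha> \<rightarrow>\<^sub>M ps_borel \<beta>" using iso by (simp add: ps_isomorphism_def)
      ultimately have "(\<lambda>t. snd (\<theta> (t, ?T t))) \<in> ?M \<rightarrow>\<^sub>M op_borel"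
        by (intro measurable_compose[OF _ measurable_snd_ps_borel]) (rule measurable_compose)
      then have "(\<lambda>t. cinner (apply_op (snd (\<theta> (t, ?T t))) (W x)) (W y)) \<in> borel_measurable ?M"
        by (rule measurable_compose[OF _ measurable_matrix_coefficient])
      then show ?thesis
        by (rule measurable_cong[THEN iffD1, rotated])
          (simp add: space_restrict_space UT \<theta> rank1_intertwiner_mem homA hilbert_iso_inv[OF W])
    qed
    \<comment> \<open>Expanding \<open>z\<close> by intertwiners and then their arguments in the basis \<open>e\<close> leaves only matrix
        coefficients of sections with constant arguments.\<close>
    have double_sum: "(\<lambda>t. \<Sum>n. \<Sum>k. cinner (apply_op (\<alpha> t (rank1 (e 0) (e n))) z) (e k) *
        cinner (apply_op (U t) (apply_op (rank1_intertwiner (\<alpha> t) (e 0) (e k)) (e n))) y) \<in> borel_measurable ?M"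
      by (rule borel_measurable_suminf, rule borel_measurable_suminf, rule borel_measurable_times)
        (rule measurable_restrict_positive[OF E0_semigroupD(6)[OF \<alpha>]], rule section_meas)
    have "(\<Sum>n. \<Sum>k. cinner (apply_op (\<alpha> t (rank1 (e 0) (e n))) z) (e k) *
        cinner (apply_op (U t) (apply_op (rank1_intertwiner (\<alpha> t) (e 0) (e k)) (e n))) y) = cinner (apply_op (U t) z) y"
      if "t \<in> space ?M" for t
    proof -
      have t: "0 < t" using that by (simp add: space_restrict_space)
      have inner: "(\<lambda>k. cinner v (e k) * cinner (apply_op (U t) (apply_op (rank1_intertwiner (\<alpha> t) (e 0) (e k)) x)) y)
          sums cinner (apply_op (U t) (apply_op (rank1_intertwiner (\<alpha> t) (e 0) v) x)) y" for v x
      proof -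
        have "bounded_linear (\<lambda>v. cinner (apply_op (U t) (apply_op (\<alpha> t (rank1 x (e 0))) v)) y)"
          by (rule bounded_linear_compose[OF bounded_linear_cinner_left
                bounded_linear_compose[OF bounded_linear_apply_op bounded_linear_apply_op]])
        from bounded_linear.sums[OF this orthonormal_expansion[OF e, of v]]
        show ?thesis by (simp add: apply_rank1_intertwiner[OF homA[OF t]] op_scaleC cinner_scaleC_left)
      qed
      let ?w = "\<lambda>n. apply_op (\<alpha> t (rank1 (e 0) (e n))) z"
      have outer: "(\<lambda>n. cinner (apply_op (U t) (apply_op (rank1_intertwiner (\<alpha> t) (e 0) (?w n)) (e n))) y)
          sums cinner (apply_op (U t) z) y"
        by (rule bounded_linear.sums[OF bounded_linear_cinner_left
              bounded_linear.sums[OF bounded_linear_apply_op intertwiner_expansion[OF norA[OF t] e u0]]])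
      have "(\<Sum>k. cinner (?w n) (e k) *
          cinner (apply_op (U t) (apply_op (rank1_intertwiner (\<alpha> t) (e 0) (e k)) (e n))) y)
        = cinner (apply_op (U t) (apply_op (rank1_intertwiner (\<alpha> t) (e 0) (?w n)) (e n))) y" for n
        by (rule sums_unique[OF inner[of "?w n" "e n"], symmetric])
      then have "(\<Sum>n. \<Sum>k. cinner (?w n) (e k) *
          cinner (apply_op (U t) (apply_op (rank1_intertwiner (\<alpha> t) (e 0) (e k)) (e n))) y)
        = (\<Sum>n. cinner (apply_op (U t) (apply_op (rank1_intertwiner (\<alpha> t) (e 0) (?w n)) (e n))) y)"
        by (rule suminf_cong)
      also have "\<dots> = cinner (apply_op (U t) z) y"
        by (rule sums_unique[OF outer, symmetric])
      finally show ?thesis .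
    qed
    from measurable_cong[OF this, THEN iffD1, OF _ double_sum] show ?thesis .
  qed
  interpret mc: measurable_cocycle \<alpha> U "e 0"
    by unfold_locales (fact \<alpha>, fact sepH, fact u0, fact unit, fact coc, fact meas)
  have cocycle: "cocycle \<alpha> U"
    unfolding cocycle_def using unit coc mc.strongly_continuous by blast

  have "spatial (inv W) (\<beta> t B) = perturbation \<alpha> U t (spatial (inv W) B)" if "0 \<le> t" for t B
  proof (cases "t = 0")
    case True
    then show ?thesis
      using E0_semigroupD(1)[OF \<alpha>] E0_semigroupD(1)[OF \<beta>] by (simp add: perturbation_def U_def)
  next
    case False
    then have t: "0 < t" using that by simp
    have inv2: "inv (inv W) = W" using W by (simp add: inv_inv_eq bij_def hilbert_iso_inj hilbert_iso_def)
    have "spatial (inv W) (\<beta> t B) * U t = U t * \<alpha> t (spatial (inv W) B)"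
    proof (rule op_eqI_intertwiners[OF norA[OF t] e])
      fix T x assume T: "T \<in> intertwiners (\<alpha> t)"
      have "apply_op (\<alpha> t (spatial (inv W) B)) (apply_op T x) = apply_op T (apply_op (spatial (inv W) B) x)"
        using T unfolding intertwiners_def by (metis (mono_tags, lifting) apply_op_simps(1) mem_Collect_eq)
      moreover have "apply_op (\<beta> t B) (apply_op (\<upsilon> t T) (W x)) = apply_op (\<upsilon> t T) (apply_op B (W x))"
        using \<upsilon>_in[OF t T] unfolding intertwiners_def by (metis (mono_tags, lifting) apply_op_simps(1) mem_Collect_eq)
      ultimately show "apply_op (spatial (inv W) (\<beta> t B) * U t) (apply_op T x)
          = apply_op (U t * \<alpha> t (spatial (inv W) B)) (apply_op T x)"
        by (simp add: UT[OF t T] apply_spatial[OF W'] inv2 hilbert_iso_inv[OF W])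
    qed
    then have "spatial (inv W) (\<beta> t B) * U t * adj (U t) = perturbation \<alpha> U t (spatial (inv W) B)"
      by (simp add: perturbation_def)
    then show ?thesis using unit[OF that] by (simp add: mult.assoc unitary_op_def)
  qed
  then have "conjugate \<beta> (perturbation \<alpha> U)"
    unfolding conjugate_def
    by (intro exI[of _ "spatial (inv W)"]) (auto simp: star_iso_spatial[OF W'] fun_eq_iff)
  then show ?thesis using cocycle by blast
qed

section \<open>From cocycles to isomorphic product systems\<close>

text \<open>
  If \<open>p\<close> is the projection onto a unit vector \<open>\<xi>\<close>, then \<open>\<theta> p\<close> is a nonzero projection; for a unit vector
  \<open>\<eta>\<close> in its range \<open>A \<xi> \<mapsto> \<theta>(A) \<eta>\<close> is the implementing unitary.  Star isomorphisms are therefore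
  automatically continuous in the weak operator topology, which is what makes the maps of product
  systems built from them measurable.
\<close>

lemma star_iso_imp_spatial:
  fixes \<theta> :: "'a::complex_hilbert_space bop \<Rightarrow> 'b::complex_hilbert_space bop" and \<xi> :: 'a
  assumes \<theta>: "star_iso \<theta>" and \<xi>: "norm \<xi> = 1"
  obtains W where "hilbert_iso W" "\<theta> = spatial W"
proof -
  have hom: "star_hom \<theta>" and bij: "bij \<theta>" using \<theta> by (auto simp: star_iso_def)
  note hD = star_homD[OF hom]
  have \<xi>\<xi>: "cinner \<xi> \<xi> = 1" using \<xi> by (simp add: cinner_self)
  define p where "p = rank1 \<xi> \<xi>"
  have pp: "p * p = p" by (simp add: p_def rank1_times_rank1 \<xi>\<xi> scaleC_one)
  have "p \<noteq> 0"
  proof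
    assume "p = 0"
    then have "apply_op p \<xi> = 0" by simp
    then show False using \<xi> by (simp add: p_def \<xi>\<xi> scaleC_one)
  qed
  then have "\<theta> p \<noteq> 0"
    using bij star_hom_zero[OF hom] by (metis bij_is_inj injD)
  then obtain y where y: "apply_op (\<theta> p) y \<noteq> 0" by (metis bop_eqI zero_bop.rep_eq)
  define \<eta> where "\<eta> = complex_of_real (1 / norm (apply_op (\<theta> p) y)) *\<^sub>C apply_op (\<theta> p) y"
  have "norm \<eta> = 1" using y by (simp add: \<eta>_def norm_scaleC norm_divide)
  then have \<eta>\<eta>: "cinner \<eta> \<eta> = 1" by (simp add: cinner_self)
  have "apply_op (\<theta> p) (apply_op (\<theta> p) y) = apply_op (\<theta> p) y"
    by (metis apply_op_simps(1) hD(3) pp)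
  then have p\<eta>: "apply_op (\<theta> p) \<eta> = \<eta>" by (simp add: \<eta>_def op_scaleC)
  define W where "W x = apply_op (\<theta> (rank1 x \<xi>)) \<eta>" for x
  have "cinner (W x) (W y) = cinner x y" for x y
  proof -
    have "cinner (W x) (W y) = cinner (apply_op (\<theta> (adj (rank1 y \<xi>) * rank1 x \<xi>)) \<eta>) \<eta>"
      by (simp add: W_def hD cinner_adj_left)
    also have "adj (rank1 y \<xi>) * rank1 x \<xi> = cinner x y *\<^sub>C p"
      by (simp add: adj_rank1 rank1_times_rank1 p_def)
    finally show ?thesis by (simp add: hD p\<eta> cinner_scaleC_left \<eta>\<eta>)
  qed
  moreover have "\<exists>x. y = W x" for y
  proof -
    obtain B where B: "rank1 y \<eta> = \<theta> B" using bij by (metis bij_pointE)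
    have "W (apply_op B \<xi>) = apply_op (\<theta> (B * p)) \<eta>" by (simp add: W_def p_def times_rank1)
    also have "\<dots> = y" by (simp add: hD p\<eta> B[symmetric] \<eta>\<eta> scaleC_one)
    finally show ?thesis by metis
  qed
  ultimately have W: "hilbert_iso W" by (auto simp: hilbert_iso_def surj_def)
  have "apply_op (\<theta> A) (W x) = W (apply_op A x)" for A x
    by (simp add: W_def times_rank1[symmetric] hD)
  then have "\<theta> A = spatial W A" for A
    by (intro bop_eqI) (metis apply_spatial[OF W] hilbert_iso_inv(2)[OF W])
  then show ?thesis by (intro that[OF W]) (rule ext)
qed

lemma intertwiners_add: "S \<in> intertwiners \<phi> \<Longrightarrow> T \<in> intertwiners \<phi> \<Longrightarrow> S + T \<in> intertwiners \<phi>"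
  by (simp add: intertwiners_def bop_times_simps)

lemma intertwiners_scaleC: "T \<in> intertwiners \<phi> \<Longrightarrow> c *\<^sub>C T \<in> intertwiners \<phi>"
  by (simp add: intertwiners_def bop_times_simps)

lemma fiber_unitary_inv:
  assumes u: "fiber_unitary (intertwiners \<phi>) (intertwiners \<psi>) u"
  shows "fiber_unitary (intertwiners \<psi>) (intertwiners \<phi>) (inv_into (intertwiners \<phi>) u)"
proof -
  let ?E = "intertwiners \<phi>" and ?F = "intertwiners \<psi>"
  let ?v = "inv_into ?E u"
  have bij: "bij_betw u ?E ?F" using u by (simp add: fiber_unitary_def)
  have v_in: "?v S \<in> ?E" and uv: "u (?v S) = S" if "S \<in> ?F" for S
    using bij that by (auto simp: bij_betw_def inv_into_into f_inv_into_f)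
  have vu: "?v (u T) = T" if "T \<in> ?E" for T
    using bij that by (simp add: bij_betw_def)
  have "?v (S + T) = ?v S + ?v T" if "S \<in> ?F" "T \<in> ?F" for S T
  proof -
    have "u (?v S + ?v T) = S + T"
      using u v_in[OF that(1)] v_in[OF that(2)] by (simp add: fiber_unitary_def uv that)
    then show ?thesis using vu intertwiners_add v_in that by metis
  qed
  moreover have "?v (c *\<^sub>C T) = c *\<^sub>C ?v T" if "T \<in> ?F" for c T
  proof -
    have "u (c *\<^sub>C ?v T) = c *\<^sub>C T"
      using u v_in[OF that] by (simp add: fiber_unitary_def uv that)
    then show ?thesis using vu intertwiners_scaleC v_in that by metis
  qed
  moreover have "fiber_inner (?v S) (?v T) = fiber_inner S T" if "S \<in> ?F" "T \<in> ?F" for S T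
  proof -
    have "fiber_inner (u (?v S)) (u (?v T)) = fiber_inner (?v S) (?v T)"
      using u v_in that unfolding fiber_unitary_def by blast
    then show ?thesis by (simp add: uv that)
  qed
  ultimately show ?thesis using bij_betw_inv_into[OF bij] by (simp add: fiber_unitary_def)
qed

lemma ps_isomorphic_sym:
  assumes \<alpha>: "E0_semigroup \<alpha>" and "ps_isomorphic \<alpha> \<beta>"
  shows "ps_isomorphic \<beta> \<alpha>"
proof -
  obtain \<theta> where iso: "ps_isomorphism \<alpha> \<beta> \<theta>" using assms(2) by (auto simp: ps_isomorphic_def)
  let ?P = "product_system \<alpha>" and ?Q = "product_system \<beta>"
  let ?\<theta>' = "inv_into ?P \<theta>"
  have bij: "bij_betw \<theta> ?P ?Q" using iso by (simp add: ps_isomorphism_def)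
  have bwd: "?\<theta>' y \<in> ?P" "\<theta> (?\<theta>' y) = y" if "y \<in> ?Q" for y
    using bij that by (auto simp: bij_betw_def inv_into_into f_inv_into_f)
  have fwd: "?\<theta>' (\<theta> x) = x" if "x \<in> ?P" for x
    using bij that by (simp add: bij_betw_def)
  have "inv_into ?Q ?\<theta>' \<in> ps_borel \<alpha> \<rightarrow>\<^sub>M ps_borel \<beta>"
  proof -
    have "\<theta> \<in> ps_borel \<alpha> \<rightarrow>\<^sub>M ps_borel \<beta>" using iso by (simp add: ps_isomorphism_def)
    then show ?thesis
      by (rule measurable_cong[THEN iffD2, rotated])
        (simp add: space_ps_borel inv_into_inv_into_eq[OF bij])
  qed
  moreover have "\<exists>v. fiber_unitary (fiber \<beta> t) (fiber \<alpha> t) v \<and> (\<forall>S\<in>fiber \<beta> t. ?\<theta>' (t, S) = (t, v S))"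
    if t: "0 < t" for t
  proof -
    obtain u where u: "fiber_unitary (intertwiners (\<alpha> t)) (intertwiners (\<beta> t)) u"
      "\<And>T. T \<in> intertwiners (\<alpha> t) \<Longrightarrow> \<theta> (t, T) = (t, u T)"
      using iso t unfolding ps_isomorphism_def fiber_eq_intertwiners by blast
    let ?v = "inv_into (intertwiners (\<alpha> t)) u"
    have "?\<theta>' (t, S) = (t, ?v S)" if S: "S \<in> intertwiners (\<beta> t)" for S
    proof -
      have "bij_betw u (intertwiners (\<alpha> t)) (intertwiners (\<beta> t))" using u(1) by (simp add: fiber_unitary_def)
      then have v: "?v S \<in> intertwiners (\<alpha> t)" "u (?v S) = S"
        using S by (auto simp: bij_betw_def inv_into_into f_inv_into_f)
      then have "\<theta> (t, ?v S) = (t, S)" using u(2) by simp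
      then show ?thesis using fwd[of "(t, ?v S)"] v(1) t by (simp add: product_system_iff)
    qed
    then show ?thesis using fiber_unitary_inv[OF u(1)] unfolding fiber_eq_intertwiners by blast
  qed
  moreover have "?\<theta>' (ps_mult x y) = ps_mult (?\<theta>' x) (?\<theta>' y)" if xy: "x \<in> ?Q" "y \<in> ?Q" for x y
  proof -
    have in_P: "?\<theta>' x \<in> ?P" "?\<theta>' y \<in> ?P" using bwd xy by auto
    then have "\<theta> (ps_mult (?\<theta>' x) (?\<theta>' y)) = ps_mult x y"
      using iso xy by (simp add: ps_isomorphism_def bwd)
    moreover have "ps_mult (?\<theta>' x) (?\<theta>' y) \<in> ?P"
      using in_P intertwiners_times[OF \<alpha>, of "fst (?\<theta>' x)" "fst (?\<theta>' y)" "snd (?\<theta>' x)" "snd (?\<theta>' y)"]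
      by (simp add: ps_mult_def product_system_def fiber_eq_intertwiners case_prod_beta)
    ultimately show ?thesis using fwd by metis
  qed
  ultimately have "ps_isomorphism \<beta> \<alpha> ?\<theta>'"
    using iso bij_betw_inv_into[OF bij] by (simp add: ps_isomorphism_def)
  then show ?thesis by (auto simp: ps_isomorphic_def)
qed

lemma measurable_fst_ps_borel:
  fixes g :: "real \<Rightarrow> complex"
  assumes "continuous_on {0..} g"
  shows "(\<lambda>p. g (fst p)) \<in> borel_measurable (ps_borel \<alpha>)"
proof -
  \<comment> \<open>The values of \<open>g\<close> at negative times are arbitrary; freezing \<open>g\<close> there makes it globally Borel.\<close>
  have "(\<lambda>t. g (max t 0)) \<in> borel_measurable borel"
    by (rule borel_measurable_continuous_onI[OF continuous_on_max_zero[OF assms]])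
  moreover have "fst \<in> ps_borel \<alpha> \<rightarrow>\<^sub>M borel"
    unfolding ps_borel_def by (rule measurable_restrict_space1) (rule measurable_fst)
  ultimately have "(\<lambda>p. g (max (fst p) 0)) \<in> borel_measurable (ps_borel \<alpha>)"
    by (rule measurable_compose[rotated])
  then show ?thesis
    by (rule measurable_cong[THEN iffD1, rotated])
      (auto simp: space_ps_borel product_system_def max_def)
qed

text \<open>
  If \<open>\<theta>\<close> conjugates \<open>\<alpha>\<close> to the perturbation of \<open>\<beta>\<close> by \<open>U\<close>, then \<open>T \<mapsto> U\<^sub>t\<^sup>* \<theta>(T)\<close> maps intertwiners of \<open>\<alpha>\<^sub>t\<close> to
  intertwiners of \<open>\<beta>\<^sub>t\<close>, with inverse \<open>S \<mapsto> \<theta>\<^sup>-\<^sup>1(U\<^sub>t S)\<close>.  It is multiplicative by the cocycle identity, as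
  an intertwiner of \<open>\<beta>\<^sub>s\<close> moves past \<open>U\<^sub>t\<^sup>*\<close> at the price of \<open>\<beta>\<^sub>s\<close>.  For measurability, the matrix
  coefficients are expanded in a basis into series of products of a matrix coefficient of the
  operator and a continuous function of time.
\<close>

lemma cocycle_perturbation_imp_ps_isomorphic:
  fixes \<alpha> :: "real \<Rightarrow> 'h::complex_hilbert_space bop \<Rightarrow> 'h bop"
    and \<beta> :: "real \<Rightarrow> 'k::complex_hilbert_space bop \<Rightarrow> 'k bop"
  assumes sepH: "separable_space (euclidean :: 'h topology)"
    and sepK: "separable_space (euclidean :: 'k topology)"
    and e: "orthonormal_basis (e :: nat \<Rightarrow> 'h)" and f: "orthonormal_basis (f :: nat \<Rightarrow> 'k)"
    and \<beta>: "E0_semigroup \<beta>"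
    and U: "cocycle \<beta> U" and conj: "conjugate \<alpha> (perturbation \<beta> U)"
  shows "ps_isomorphic \<alpha> \<beta>"
proof -
  obtain \<theta> where \<theta>: "star_iso \<theta>" "\<And>t. 0 \<le> t \<Longrightarrow> \<theta> \<circ> \<alpha> t = perturbation \<beta> U t \<circ> \<theta>"
    using conj by (auto simp: conjugate_def)
  obtain W where W: "hilbert_iso W" "\<theta> = spatial W"
    using star_iso_imp_spatial[OF \<theta>(1) orthonormal_basis_norm[OF e]] by blast
  note W' = hilbert_iso_inv(1)[OF W(1)]
  have inv2: "inv (inv W) = W"
    using W(1) by (simp add: inv_inv_eq bij_def hilbert_iso_inj hilbert_iso_def)
  define \<theta>' where "\<theta>' = spatial (inv W)"
  have \<theta>\<theta>': "\<theta> (\<theta>' B) = B" and \<theta>'\<theta>: "\<theta>' (\<theta> A) = A" for A B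
    by (simp_all add: W(2) \<theta>'_def spatial_inv[OF W(1)])
  have hom: "star_hom \<theta>" using \<theta>(1) by (simp add: star_iso_def)
  note hD = star_homD[OF hom]
  have hom_one: "\<theta> 1 = 1"
    by (rule bop_eqI) (simp add: W(2) apply_spatial[OF W(1)] hilbert_iso_inv[OF W(1)])
  have unit: "unitary_op (U t)" if "0 \<le> t" for t using U that by (simp add: cocycle_def)
  have UU: "adj (U t) * (U t * X) = X" "U t * (adj (U t) * X) = X" if "0 \<le> t" for t X
    using unit[OF that] by (simp_all add: unitary_op_def mult.assoc[symmetric])
  have \<theta>\<alpha>: "\<theta> (\<alpha> t A) = U t * (\<beta> t (\<theta> A) * adj (U t))" if "0 \<le> t" for t A
    using fun_cong[OF \<theta>(2)[OF that], of A] by (simp add: perturbation_def mult.assoc)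
  define u where "u t T = adj (U t) * \<theta> T" for t T
  define v where "v t S = \<theta>' (U t * S)" for t S
  have uv: "u t (v t S) = S" and vu: "v t (u t T) = T" if "0 \<le> t" for t S T
    by (simp_all add: u_def v_def \<theta>\<theta>' \<theta>'\<theta> UU that)
  have u_in: "u t T \<in> intertwiners (\<beta> t)" if t: "0 \<le> t" and T: "T \<in> intertwiners (\<alpha> t)" for t T
  proof -
    have "\<beta> t B * u t T = u t T * B" for B
    proof -
      have "\<beta> t B * u t T = adj (U t) * (\<theta> (\<alpha> t (\<theta>' B)) * \<theta> T)"
        by (simp add: \<theta>\<alpha>[OF t] \<theta>\<theta>' u_def mult.assoc UU[OF t])
      also have "\<theta> (\<alpha> t (\<theta>' B)) * \<theta> T = \<theta> T * B"
        using T by (simp add: hD(3)[symmetric] intertwiners_def) (simp add: hD(3) \<theta>\<theta>')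
      finally show ?thesis by (simp add: u_def mult.assoc)
    qed
    then show ?thesis by (simp add: intertwiners_def)
  qed
  have v_in: "v t S \<in> intertwiners (\<alpha> t)" if t: "0 \<le> t" and S: "S \<in> intertwiners (\<beta> t)" for t S
  proof -
    have "\<alpha> t A * v t S = v t S * A" for A
    proof -
      have "\<theta> (\<alpha> t A * v t S) = U t * (\<beta> t (\<theta> A) * S)"
        by (simp add: hD(3) v_def \<theta>\<theta>' \<theta>\<alpha>[OF t] mult.assoc UU[OF t])
      also have "\<dots> = U t * (S * \<theta> A)" using S by (simp add: intertwiners_def)
      also have "\<dots> = \<theta> (v t S * A)" by (simp add: hD(3) v_def \<theta>\<theta>' mult.assoc)
      finally show ?thesis by (metis \<theta>'\<theta>)
    qed
    then show ?thesis by (simp add: intertwiners_def)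
  qed
  have bij_u: "bij_betw (u t) (intertwiners (\<alpha> t)) (intertwiners (\<beta> t))" if "0 \<le> t" for t
    by (rule bij_betw_byWitness[where f' = "v t"]) (use that uv vu u_in v_in in auto)

  define F where "F p = (fst p, u (fst p) (snd p))" for p
  define G where "G q = (fst q, v (fst q) (snd q))" for q
  have F_in: "F p \<in> product_system \<beta>" if "p \<in> product_system \<alpha>" for p
    using that u_in[of "fst p" "snd p"] by (cases p) (simp add: F_def product_system_iff)
  have G_in: "G q \<in> product_system \<alpha>" if "q \<in> product_system \<beta>" for q
    using that v_in[of "fst q" "snd q"] by (cases q) (simp add: G_def product_system_iff)
  have FG: "F (G q) = q" if "q \<in> product_system \<beta>" for q
    using that by (auto simp: F_def G_def uv product_system_def)
  have GF: "G (F p) = p" if "p \<in> product_system \<alpha>" for p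
    using that by (auto simp: F_def G_def vu product_system_def)
  have bij_F: "bij_betw F (product_system \<alpha>) (product_system \<beta>)"
    by (rule bij_betw_byWitness[where f' = G]) (use F_in G_in FG GF in auto)
  have cont: "continuous_on {0..} (\<lambda>t. cinner (apply_op (U t) x) y)" for x y
    by (rule bounded_linear.continuous_on[OF bounded_linear_cinner_left])
      (use U in \<open>simp add: cocycle_def\<close>)

  have "F \<in> ps_borel \<alpha> \<rightarrow>\<^sub>M ps_borel \<beta>"
    unfolding F_def
  proof (rule measurable_into_ps_borel)
    show "fst \<in> ps_borel \<alpha> \<rightarrow>\<^sub>M borel"
      unfolding ps_borel_def by (rule measurable_restrict_space1) (rule measurable_fst)
    show "(fst p, u (fst p) (snd p)) \<in> product_system \<beta>" if "p \<in> space (ps_borel \<alpha>)" for p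
      using F_in that by (simp add: F_def space_ps_borel)
    show "(\<lambda>p. u (fst p) (snd p)) \<in> ps_borel \<alpha> \<rightarrow>\<^sub>M op_borel"
    proof (rule measurable_op_borelI[OF sepK])
      fix x y :: 'k
      have "(\<lambda>p. \<Sum>n. cinner (apply_op (snd p) (inv W x)) (e n) *
          cnj (cinner (apply_op (U (fst p)) y) (W (e n)))) \<in> borel_measurable (ps_borel \<alpha>)"
        by (rule borel_measurable_suminf, rule borel_measurable_times)
          (rule measurable_compose[OF measurable_snd_ps_borel measurable_matrix_coefficient],
            rule measurable_fst_ps_borel[OF continuous_on_cnj[OF cont]])
      moreover have "(\<Sum>n. cinner (apply_op T (inv W x)) (e n) * cnj (cinner (apply_op (U t) y) (W (e n))))
          = cinner (apply_op (u t T) x) y" for t T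
      proof -
        have "(\<lambda>n. cinner (cinner (apply_op T (inv W x)) (e n) *\<^sub>C e n) (inv W (apply_op (U t) y)))
            sums cinner (apply_op T (inv W x)) (inv W (apply_op (U t) y))"
          by (rule bounded_linear.sums[OF bounded_linear_cinner_left orthonormal_expansion[OF e]])
        moreover have "cinner (e n) (inv W (apply_op (U t) y)) = cnj (cinner (apply_op (U t) y) (W (e n)))" for n
          by (metis cinner_commute hilbert_iso_inv(4)[OF W(1)])
        moreover have "cinner (apply_op (u t T) x) y = cinner (apply_op T (inv W x)) (inv W (apply_op (U t) y))"
          by (simp add: u_def cinner_adj_left W(2) apply_spatial[OF W(1)] hilbert_iso_inv(4)[OF W(1)])
        ultimately show ?thesis by (simp add: cinner_scaleC_left sums_iff)
      qed
      ultimately show "(\<lambda>p. cinner (apply_op (u (fst p) (snd p)) x) y) \<in> borel_measurable (ps_borel \<alpha>)"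
        by simp
    qed
  qed
  moreover have "inv_into (product_system \<alpha>) F \<in> ps_borel \<beta> \<rightarrow>\<^sub>M ps_borel \<alpha>"
  proof -
    have "G \<in> ps_borel \<beta> \<rightarrow>\<^sub>M ps_borel \<alpha>"
      unfolding G_def
    proof (rule measurable_into_ps_borel)
      show "fst \<in> ps_borel \<beta> \<rightarrow>\<^sub>M borel"
        unfolding ps_borel_def by (rule measurable_restrict_space1) (rule measurable_fst)
      show "(fst q, v (fst q) (snd q)) \<in> product_system \<alpha>" if "q \<in> space (ps_borel \<beta>)" for q
        using G_in that by (simp add: G_def space_ps_borel)
      show "(\<lambda>q. v (fst q) (snd q)) \<in> ps_borel \<beta> \<rightarrow>\<^sub>M op_borel"
      proof (rule measurable_op_borelI[OF sepH])
        fix x y :: 'h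
        have "(\<lambda>q. \<Sum>n. cinner (apply_op (snd q) (W x)) (f n) *
            cinner (apply_op (U (fst q)) (f n)) (W y)) \<in> borel_measurable (ps_borel \<beta>)"
          by (rule borel_measurable_suminf, rule borel_measurable_times)
            (rule measurable_compose[OF measurable_snd_ps_borel measurable_matrix_coefficient],
              rule measurable_fst_ps_borel[OF cont])
        moreover have "(\<Sum>n. cinner (apply_op S (W x)) (f n) * cinner (apply_op (U t) (f n)) (W y))
            = cinner (apply_op (v t S) x) y" for t S
        proof -
          have "(\<lambda>n. cinner (apply_op (U t) (cinner (apply_op S (W x)) (f n) *\<^sub>C f n)) (W y))
              sums cinner (apply_op (U t) (apply_op S (W x))) (W y)"
            by (rule bounded_linear.sums[OF bounded_linear_cinner_left
                  bounded_linear.sums[OF bounded_linear_apply_op orthonormal_expansion[OF f]]])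
          moreover have "cinner (apply_op (v t S) x) y = cinner (apply_op (U t) (apply_op S (W x))) (W y)"
            by (simp add: v_def \<theta>'_def apply_spatial[OF W'] inv2 hilbert_iso_inv(5)[OF W(1)])
          ultimately show ?thesis by (simp add: op_scaleC cinner_scaleC_left sums_iff)
        qed
        ultimately show "(\<lambda>q. cinner (apply_op (v (fst q) (snd q)) x) y) \<in> borel_measurable (ps_borel \<beta>)"
          by simp
      qed
    qed
    moreover have "inv_into (product_system \<alpha>) F q = G q" if "q \<in> space (ps_borel \<beta>)" for q
      using bij_F FG G_in that by (metis bij_betw_def inv_into_f_f space_ps_borel)
    ultimately show ?thesis by (simp cong: measurable_cong)
  qed
  moreover have "\<exists>u. fiber_unitary (fiber \<alpha> t) (fiber \<beta> t) u \<and> (\<forall>T\<in>fiber \<alpha> t. F (t, T) = (t, u T))"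
    if t: "0 < t" for t
  proof (intro exI conjI ballI)
    have "fiber_inner (u t S) (u t T) = fiber_inner S T" for S T
    proof -
      have "adj (u t T) * u t S = \<theta> (adj T * S)"
        using t by (simp add: u_def adj_times mult.assoc UU hD)
      moreover have "\<theta> (adj T * S) = c *\<^sub>C 1 \<longleftrightarrow> adj T * S = c *\<^sub>C 1" for c
        by (metis \<theta>'\<theta> hD(2) hom_one)
      ultimately show ?thesis by (simp add: fiber_inner_def)
    qed
    then show "fiber_unitary (fiber \<alpha> t) (fiber \<beta> t) (u t)"
      unfolding fiber_unitary_def fiber_eq_intertwiners
      using bij_u[of t] t by (simp add: u_def hD bop_times_simps)
  qed (simp add: F_def)
  moreover have "F (ps_mult p q) = ps_mult (F p) (F q)"
    if pq: "p \<in> product_system \<alpha>" "q \<in> product_system \<alpha>" for p q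
  proof -
    obtain s S t T where p: "p = (s, S)" "q = (t, T)" by (cases p, cases q)
    have st: "0 \<le> s" "0 \<le> t" and S: "S \<in> intertwiners (\<alpha> s)"
      using pq by (auto simp: p product_system_iff)
    have "U (s + t) = U s * \<beta> s (U t)" using U st by (simp add: cocycle_def)
    then have "u (s + t) (S * T) = (\<beta> s (adj (U t)) * u s S) * \<theta> T"
      using star_homD(4)[OF E0_semigroupD(4)[OF \<beta> st(1)]] by (simp add: u_def adj_times hD mult.assoc)
    also have "\<beta> s (adj (U t)) * u s S = u s S * adj (U t)"
      using u_in[OF st(1) S] by (simp add: intertwiners_def)
    finally show ?thesis by (simp add: F_def ps_mult_def p u_def mult.assoc)
  qed
  ultimately have "ps_isomorphism \<alpha> \<beta> F"
    using bij_F by (simp add: ps_isomorphism_def)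
  then show ?thesis by (auto simp: ps_isomorphic_def)
qed

theorem theorem3p1p4:
  fixes \<alpha> :: "real \<Rightarrow> 'h::complex_hilbert_space bop \<Rightarrow> 'h bop"
    and \<beta> :: "real \<Rightarrow> 'k::complex_hilbert_space bop \<Rightarrow> 'k bop"
  assumes "separable_space (euclidean :: 'h topology)" and "infinite_dimensional TYPE('h)"
    and "separable_space (euclidean :: 'k topology)" and "infinite_dimensional TYPE('k)"
    and "E0_semigroup \<alpha>" and "E0_semigroup \<beta>"
  shows "cocycle_conjugate \<alpha> \<beta> \<longleftrightarrow> ps_isomorphic \<alpha> \<beta>"
proof -
  obtain e :: "nat \<Rightarrow> 'h" where e: "orthonormal_basis e"
    using exists_orthonormal_basis[OF assms(1,2)] by blast
  obtain f :: "nat \<Rightarrow> 'k" where f: "orthonormal_basis f"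
    using exists_orthonormal_basis[OF assms(3,4)] by blast
  show ?thesis
  proof
    assume "cocycle_conjugate \<alpha> \<beta>"
    then consider U where "cocycle \<beta> U" "conjugate \<alpha> (perturbation \<beta> U)"
      | U where "cocycle \<alpha> U" "conjugate \<beta> (perturbation \<alpha> U)"
      unfolding cocycle_conjugate_def by blast
    then show "ps_isomorphic \<alpha> \<beta>"
    proof cases
      case 1
      then show ?thesis
        by (rule cocycle_perturbation_imp_ps_isomorphic[OF assms(1,3) e f assms(6)])
    next
      case 2
      then have "ps_isomorphic \<beta> \<alpha>"
        by (rule cocycle_perturbation_imp_ps_isomorphic[OF assms(3,1) f e assms(5)])
      then show ?thesis by (rule ps_isomorphic_sym[OF assms(6)])
    qed
  next
    assume "ps_isomorphic \<alpha> \<beta>"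
    then obtain \<theta> where "ps_isomorphism \<alpha> \<beta> \<theta>" by (auto simp: ps_isomorphic_def)
    from ps_isomorphic_imp_cocycle_conjugate[OF assms(1,3) e f assms(5,6) this]
    show "cocycle_conjugate \<alpha> \<beta>" unfolding cocycle_conjugate_def by blast
  qed
qed

end
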